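(* Let $L,B,C,P>0$ be constants, let $c:=\max\left\{L,\frac{L^3}{\pi^2}\right\}$ and let $T>2c$. Then every solution $z$ of the system $$\begin{cases}\ddot z+z''''+B^2(Jz')'=0, & (x,t)\in(0,L)\times\mathbb{R}^+,\\ z(0,t)=z'(0,t)=\phi(0,t)=0,& t\in\mathbb{R}^+,\\ \phi'(L,t)=z''(L,t)=z'''(L,t)-B\phi(L,t)=0, & t\in\mathbb{R}^+,\\ z(x,0)=z^0(x),\quad \dot z(x,0)=z^1(x),& x\in[0,L],\end{cases}$$ where $\phi:=-BJz'$, satisfies the observability inequality $$\int_0^T|\dot z(L,t)|^2\,dt\ \ge\ \frac{2}{L}\,(T-2c)\,E(0).$$
   Context: Here a dot denotes $\partial_t$ and a prime denotes $\partial_x$. The operator $D_x^2=\frac{d^2}{dx^2}$ has domain $\mathrm{Dom}(D_x^2)=\{\psi\in H^2(0,L):\psi(0)=\psi_x(L)=0\}$; the operator $-CD_x^2+PI$ on this domain is positive definite, self-adjoint and boundedly invertible on $L^2(0,L)$, and $$J:=-\frac1C I+\frac PC\left(-CD_x^2+PI\right)^{-1}$$ is a bounded, self-adjoint, non-positive operator on $L^2(0,L)$. With $\phi=-BJz'$ the system is the three-layer Mead-Marcus sandwich beam $\ddot z+z''''-B\phi'=0$, $-C\phi''+P\phi=-Bz'''$ with clamped-free boundary conditions. The energy of a solution is $$E(t):=\frac12\int_0^L\left[|\dot z|^2+|z''|^2-B^2(Jz')z'\right]dx ,$$ which is constant in time along solutions. Solutions: let $V=\{\psi\in H^2(0,L):\psi(0)=\psi'(0)=0\}$,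 $\mathcal H=V\times L^2(0,L)$, and let $\mathcal D$ be the set of $(z_1,z_2)\in\mathcal H$ with $z_2\in V$, $z_1'''+B^2Jz_1'\in H^1(0,L)$, $z_1''(L)=0$ and $z_1'''(L)+B^2(Jz_1')(L)=0$. A solution is understood with $(z^0,z^1)\in\mathcal D$ and $(z,\dot z)\in C([0,\infty);\mathcal D)\cap C^1([0,\infty);\mathcal H)$, so that $\dot z(L,t)$ is well defined. *)

theory Defs
  imports "HOL-Analysis.Analysis"
begin

text \<open>Elements of \<open>L\<^sup>2(0,L)\<close> are represented by functions on the reals whose values outside
  the interval are irrelevant; all scalars are real.\<close>

definition L2 :: "real \<Rightarrow> (real \<Rightarrow> real) \<Rightarrow> bool" where
  "L2 L f \<longleftrightarrow> f \<in> borel_measurable (lebesgue_on {0<..<L}) \<and>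
              integrable (lebesgue_on {0<..<L}) (\<lambda>x. (f x)\<^sup>2)"

definition norm_L2 :: "real \<Rightarrow> (real \<Rightarrow> real) \<Rightarrow> real" where
  "norm_L2 L f = sqrt (LINT x|lebesgue_on {0<..<L}. (f x)\<^sup>2)"

text \<open>Weak derivatives are tested against \<open>C\<^sup>1\<close> functions with compact support in \<open>(0,L)\<close>; in
  \<open>L\<^sup>2\<close> this gives the same notion as smooth test functions.\<close>

definition test_function :: "real \<Rightarrow> (real \<Rightarrow> real) \<Rightarrow> bool" where
  "test_function L \<phi> \<longleftrightarrow> \<phi> C1_differentiable_on UNIV \<and>
     (\<exists>a b. 0 < a \<and> a \<le> b \<and> b < L \<and> (\<forall>x. x \<notin> {a..b} \<longrightarrow> \<phi> x = 0))"

definition weak_deriv :: "real \<Rightarrow> (real \<Rightarrow> real) \<Rightarrow> (real \<Rightarrow> real) \<Rightarrow> bool" where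
  "weak_deriv L f g \<longleftrightarrow> L2 L f \<and> L2 L g \<and>
     (\<forall>\<phi>. test_function L \<phi> \<longrightarrow>
        (LINT x|lebesgue_on {0<..<L}. f x * deriv \<phi> x) =
        - (LINT x|lebesgue_on {0<..<L}. g x * \<phi> x))"

text \<open>The weak derivative is unique up to null sets. Whenever it has a representative that is
  continuous on \<open>[0,L]\<close>, that representative (unique on \<open>[0,L]\<close>) is the one selected, so that
  boundary values of derivatives can be written as plain evaluations.\<close>

definition wderiv :: "real \<Rightarrow> (real \<Rightarrow> real) \<Rightarrow> real \<Rightarrow> real" where
  "wderiv L f = (SOME g. weak_deriv L f g \<and>
     ((\<exists>h. weak_deriv L f h \<and> continuous_on {0..L} h) \<longrightarrow> continuous_on {0..L} g))"

abbreviation wderivs :: "real \<Rightarrow> nat \<Rightarrow> (real \<Rightarrow> real) \<Rightarrow> real \<Rightarrow> real" where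
  "wderivs L n f \<equiv> (wderiv L ^^ n) f"

text \<open>A function counts as an element of \<open>H\<^sup>1\<close> or \<open>H\<^sup>2\<close> only if it is the continuous
  representative of its class.\<close>

definition H1 :: "real \<Rightarrow> (real \<Rightarrow> real) \<Rightarrow> bool" where
  "H1 L f \<longleftrightarrow> continuous_on {0..L} f \<and> (\<exists>g. weak_deriv L f g)"

definition H2 :: "real \<Rightarrow> (real \<Rightarrow> real) \<Rightarrow> bool" where
  "H2 L f \<longleftrightarrow> H1 L f \<and> H1 L (wderiv L f)"

definition norm_H2 :: "real \<Rightarrow> (real \<Rightarrow> real) \<Rightarrow> real" where
  "norm_H2 L f =
     sqrt ((norm_L2 L f)\<^sup>2 + (norm_L2 L (wderivs L 1 f))\<^sup>2 + (norm_L2 L (wderivs L 2 f))\<^sup>2)"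

definition dom_Dx2 :: "real \<Rightarrow> (real \<Rightarrow> real) set" where
  "dom_Dx2 L = {\<psi>. H2 L \<psi> \<and> \<psi> 0 = 0 \<and> wderiv L \<psi> L = 0}"

definition elliptic_inv :: "real \<Rightarrow> real \<Rightarrow> real \<Rightarrow> (real \<Rightarrow> real) \<Rightarrow> real \<Rightarrow> real" where
  "elliptic_inv L C P f = (SOME u. u \<in> dom_Dx2 L \<and>
     (AE x in lebesgue_on {0<..<L}. - C * wderivs L 2 u x + P * u x = f x))"

definition J :: "real \<Rightarrow> real \<Rightarrow> real \<Rightarrow> (real \<Rightarrow> real) \<Rightarrow> real \<Rightarrow> real" where
  "J L C P f = (\<lambda>x. - (1 / C) * f x + P / C * elliptic_inv L C P f x)"

type_synonym state = "(real \<Rightarrow> real) \<times> (real \<Rightarrow> real)"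

definition V_space :: "real \<Rightarrow> (real \<Rightarrow> real) set" where
  "V_space L = {\<psi>. H2 L \<psi> \<and> \<psi> 0 = 0 \<and> wderiv L \<psi> 0 = 0}"

definition H_space :: "real \<Rightarrow> state set" where
  "H_space L = {(u, v). u \<in> V_space L \<and> L2 L v}"

definition norm_H :: "real \<Rightarrow> state \<Rightarrow> real" where
  "norm_H L = (\<lambda>(u, v). sqrt ((norm_H2 L u)\<^sup>2 + (norm_L2 L v)\<^sup>2))"

definition flux :: "real \<Rightarrow> real \<Rightarrow> real \<Rightarrow> real \<Rightarrow> (real \<Rightarrow> real) \<Rightarrow> real \<Rightarrow> real" where
  "flux L B C P u = (\<lambda>x. wderivs L 3 u x + B\<^sup>2 * J L C P (wderiv L u) x)"

text \<open>For \<open>u\<close> in \<open>V\<close> the function \<open>J u'\<close> is in \<open>H\<^sup>1\<close>, so \<open>u''' + B\<^sup>2 J u' \<in> H\<^sup>1\<close>, read in the sense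
  of distributions, forces \<open>u'''\<close> to be square integrable; hence the explicit requirement that
  \<open>u''\<close> has a weak derivative.\<close>

definition D_space :: "real \<Rightarrow> real \<Rightarrow> real \<Rightarrow> real \<Rightarrow> state set" where
  "D_space L B C P = {(u, v). (u, v) \<in> H_space L \<and> v \<in> V_space L \<and>
     (\<exists>g. weak_deriv L (wderivs L 2 u) g) \<and> H1 L (flux L B C P u) \<and>
     wderivs L 2 u L = 0 \<and> flux L B C P u L = 0}"

text \<open>The topology of the domain is that of the graph norm of the generator
  \<open>(u, v) \<mapsto> (v, - (u''' + B\<^sup>2 J u')')\<close>.\<close>

definition generator :: "real \<Rightarrow> real \<Rightarrow> real \<Rightarrow> real \<Rightarrow> state \<Rightarrow> state" where
  "generator L B C P = (\<lambda>(u, v). (v, \<lambda>x. - wderiv L (flux L B C P u) x))"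

definition norm_D :: "real \<Rightarrow> real \<Rightarrow> real \<Rightarrow> real \<Rightarrow> state \<Rightarrow> real" where
  "norm_D L B C P w = sqrt ((norm_H L w)\<^sup>2 + (norm_H L (generator L B C P w))\<^sup>2)"

definition state_diff :: "state \<Rightarrow> state \<Rightarrow> state" where
  "state_diff p q = (\<lambda>x. fst p x - fst q x, \<lambda>x. snd p x - snd q x)"

definition state_scale :: "real \<Rightarrow> state \<Rightarrow> state" where
  "state_scale a p = (\<lambda>x. a * fst p x, \<lambda>x. a * snd p x)"

definition C0_curve :: "(state \<Rightarrow> real) \<Rightarrow> state set \<Rightarrow> (real \<Rightarrow> state) \<Rightarrow> bool" where
  "C0_curve N X w \<longleftrightarrow> (\<forall>t\<ge>0. w t \<in> X \<and>
     ((\<lambda>s. N (state_diff (w s) (w t))) \<longlongrightarrow> 0) (at t within {0..}))"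

definition C1_curve ::
  "(state \<Rightarrow> real) \<Rightarrow> state set \<Rightarrow> (real \<Rightarrow> state) \<Rightarrow> (real \<Rightarrow> state) \<Rightarrow> bool" where
  "C1_curve N X w w' \<longleftrightarrow> C0_curve N X w \<and> C0_curve N X w' \<and>
     (\<forall>t\<ge>0. ((\<lambda>s. N (state_diff (state_scale (1 / (s - t)) (state_diff (w s) (w t))) (w' t)))
        \<longlongrightarrow> 0) (at t within {0..}))"

text \<open>A time dependent function is written \<open>z t x\<close>. Its time derivative is taken pointwise in \<open>x\<close>
  (one-sided at \<open>t = 0\<close>); for a curve that is differentiable with values in \<open>V\<close> this agrees on
  \<open>[0,L]\<close> with the derivative in \<open>V\<close>, because \<open>V\<close> embeds continuously into \<open>C[0,L]\<close>.\<close>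

definition zdot :: "(real \<Rightarrow> real \<Rightarrow> real) \<Rightarrow> real \<Rightarrow> real \<Rightarrow> real" where
  "zdot z t = (\<lambda>x. vector_derivative (\<lambda>s. z s x) (at t within {0..}))"

definition phi :: "real \<Rightarrow> real \<Rightarrow> real \<Rightarrow> real \<Rightarrow> (real \<Rightarrow> real) \<Rightarrow> real \<Rightarrow> real" where
  "phi L B C P u = (\<lambda>x. - B * J L C P (wderiv L u) x)"

text \<open>The second component of the derivative \<open>w'\<close> of \<open>(z, zdot z)\<close> in \<open>V \<times> L\<^sup>2\<close> is the second
  time derivative of \<open>z\<close>, as an element of \<open>L\<^sup>2(0,L)\<close>.\<close>

definition beam_solution ::
  "real \<Rightarrow> real \<Rightarrow> real \<Rightarrow> real \<Rightarrow> (real \<Rightarrow> real) \<Rightarrow> (real \<Rightarrow> real) \<Rightarrow> (real \<Rightarrow> real \<Rightarrow> real) \<Rightarrow> bool" where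
  "beam_solution L B C P z0 z1 z \<longleftrightarrow>
     (z0, z1) \<in> D_space L B C P \<and>
     C0_curve (norm_D L B C P) (D_space L B C P) (\<lambda>t. (z t, zdot z t)) \<and>
     (\<exists>w'. C1_curve (norm_H L) (H_space L) (\<lambda>t. (z t, zdot z t)) w' \<and>
        (\<forall>t>0. AE x in lebesgue_on {0<..<L}.
           snd (w' t) x + wderivs L 4 (z t) x
             + B\<^sup>2 * wderiv L (J L C P (wderiv L (z t))) x = 0)) \<and>
     (\<forall>t>0. z t 0 = 0 \<and> wderiv L (z t) 0 = 0 \<and> phi L B C P (z t) 0 = 0) \<and>
     (\<forall>t>0. wderiv L (phi L B C P (z t)) L = 0 \<and> wderivs L 2 (z t) L = 0 \<and>
        wderivs L 3 (z t) L - B * phi L B C P (z t) L = 0) \<and>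
     (\<forall>x\<in>{0..L}. z 0 x = z0 x \<and> zdot z 0 x = z1 x)"

definition energy ::
  "real \<Rightarrow> real \<Rightarrow> real \<Rightarrow> real \<Rightarrow> (real \<Rightarrow> real \<Rightarrow> real) \<Rightarrow> real \<Rightarrow> real" where
  "energy L B C P z t = 1 / 2 * (LINT x|lebesgue_on {0<..<L}.
     \<bar>zdot z t x\<bar>\<^sup>2 + \<bar>wderivs L 2 (z t) x\<bar>\<^sup>2
       - B\<^sup>2 * J L C P (wderiv L (z t)) x * wderiv L (z t) x)"

end

theory Submission
  imports Defs
begin

text \<open>Let \<open>w = z'\<close> and \<open>\<rho> = \<integral> z\<^sub>t x w\<close>. The radial multiplier gives
  \<open>\<rho>' \<le> L/2 z\<^sub>t(L,\<cdot>)\<^sup>2 - E\<close>, but \<open>\<bar>\<rho>\<bar> \<le> c E\<close> can fail, since the Poincare constant of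
  \<open>w\<close>, which vanishes only at \<open>0\<close>, is \<open>4 L\<^sup>2 / \<pi>\<^sup>2\<close>. The loss is recovered by partial
  equipartition of the energy. Put \<open>\<mu> = \<pi>\<^sup>2 / (4 L\<^sup>2)\<close>, \<open>s = B\<^sup>2 / (C \<mu> + P)\<close>,
  \<open>k = 1 / (1 + s)\<close> and \<open>X = \<integral> z\<^sub>t (x w - k z / 2)\<close>. Then \<open>X' \<le> L/2 z\<^sub>t(L,\<cdot>)\<^sup>2 - (1 + k) E\<close>.
  The potential energy satisfies \<open>(1 + s) \<mu> \<parallel>w\<parallel>\<^sup>2 \<le> N := \<parallel>z''\<parallel>\<^sup>2 - B\<^sup>2 (Jw,w)\<close>, and a weighted Hardy
  inequality gives \<open>\<parallel>x w - k z / 2\<parallel> \<le> L \<parallel>w\<parallel>\<close>; together with \<open>4 k \<le> (1 + k)\<^sup>2\<close> this yields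
  \<open>\<bar>X\<bar> \<le> (1 + k) (L\<^sup>2 / \<pi>) E \<le> (1 + k) c E\<close>. Integrating over \<open>[0,T]\<close> and dividing by \<open>1 + k \<ge> 1\<close>
  proves the inequality.\<close>

subsection \<open>The inner product of \<open>L\<^sup>2(0,L)\<close>\<close>

text \<open>The value of \<open>k\<close> comes from a balance. Subtracting k z / 2 in the
  multiplier moves weight from the elastic to the kinetic part of X'. When the terms of X' + (1 + k)
  E are collected, one has the wrong sign: k B^2 C times the squared norm of Jw. The estimate used
  absorbs it into (1 - k) times the squared norm of z'' as long as (1 - k)(C \<mu> + P) is at least
  k B^2, and \<open>k\<close> is the equality case. The same equality turns the factor 1 + s in the
  lower bound for N into 1 / k, so the two losses cancel for all parameters. The constant L^2 /
  \<pi> is the geometric mean of the two entries of the maximum c.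

  The technical obstacle is low regularity. A state has z''' continuous but z'''' only in L^2, the
  velocity has its second derivative only in L^2, and \<open>wderiv\<close> is a choice among
  representatives. So derivatives are made classical up to the boundary wherever possible,
  integration by parts pairs one weak factor with one C^1 factor, and the time derivatives of E and
  X are computed from difference quotients converging in norm.\<close>

definition ip :: "real \<Rightarrow> (real \<Rightarrow> real) \<Rightarrow> (real \<Rightarrow> real) \<Rightarrow> real" where
  "ip L f g = (LINT x|lebesgue_on {0<..<L}. f x * g x)"

lemma integrable_continuous_Ioo:
  fixes f :: "real \<Rightarrow> real"
  assumes "continuous_on {0..L} f"
  shows "integrable (lebesgue_on {0<..<L}) f"
proof -
  have "bounded (f ` {0..L})"
    using assms by (intro compact_imp_bounded compact_continuous_image) auto
  then obtain b where b: "\<And>x. x \<in> {0..L} \<Longrightarrow> norm (f x) \<le> b"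
    unfolding bounded_iff by fastforce
  interpret finite_measure "lebesgue_on {0<..<L}"
    by (intro finite_measure_lebesgue_on) (simp add: bounded_set_imp_lmeasurable)
  show ?thesis
  proof (rule integrable_const_bound)
    show "f \<in> borel_measurable (lebesgue_on {0<..<L})"
      by (rule continuous_imp_measurable_on_sets_lebesgue)
        (auto intro: continuous_on_subset[OF assms])
    show "AE x in lebesgue_on {0<..<L}. norm (f x) \<le> b"
      using b by (intro AE_I2) auto
  qed
qed

lemma L2_continuous: "continuous_on {0..L} f \<Longrightarrow> L2 L f"
  unfolding L2_def
  by (auto intro!: integrable_continuous_Ioo continuous_intros borel_measurable_integrable)

lemma L2_mult_integrable:
  assumes "L2 L f" "L2 L g"
  shows "integrable (lebesgue_on {0<..<L}) (\<lambda>x. f x * g x)"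
proof (rule Bochner_Integration.integrable_bound)
  show "integrable (lebesgue_on {0<..<L}) (\<lambda>x. (f x)\<^sup>2 + (g x)\<^sup>2)"
    using assms by (auto simp: L2_def)
  show "(\<lambda>x. f x * g x) \<in> borel_measurable (lebesgue_on {0<..<L})"
    using assms by (auto simp: L2_def)
  have "\<bar>a * b\<bar> \<le> \<bar>a\<^sup>2 + b\<^sup>2\<bar>" for a b :: real
  proof -
    have "0 \<le> (\<bar>a\<bar> - \<bar>b\<bar>)\<^sup>2" by simp
    then have "2 * (\<bar>a\<bar> * \<bar>b\<bar>) \<le> a\<^sup>2 + b\<^sup>2"
      by (simp add: power2_diff)
    moreover have "0 \<le> \<bar>a\<bar> * \<bar>b\<bar>" by simp
    ultimately show ?thesis unfolding abs_mult by linarith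
  qed
  then show "AE x in lebesgue_on {0<..<L}. norm (f x * g x) \<le> norm ((f x)\<^sup>2 + (g x)\<^sup>2)"
    by simp
qed

lemma L2_cmult: "L2 L f \<Longrightarrow> L2 L (\<lambda>x. c * f x)"
  by (auto simp: L2_def power_mult_distrib)

lemma L2_add:
  assumes "L2 L f" "L2 L g"
  shows "L2 L (\<lambda>x. f x + g x)"
  using assms L2_mult_integrable[OF assms]
  by (auto simp: L2_def power2_sum mult.assoc)

lemma L2_diff:
  assumes "L2 L f" "L2 L g"
  shows "L2 L (\<lambda>x. f x - g x)"
  using L2_add[OF assms(1) L2_cmult[OF assms(2), of "-1"]] by simp

lemma L2_integrable: "L2 L f \<Longrightarrow> integrable (lebesgue_on {0<..<L}) f"
  using L2_mult_integrable[of L f "\<lambda>_. 1"] L2_continuous[of L "\<lambda>_. 1"] by simp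

lemma ip_cong:
  assumes "\<And>x. x \<in> {0<..<L} \<Longrightarrow> f x * g x = f' x * g' x"
  shows "ip L f g = ip L f' g'"
  unfolding ip_def by (rule Bochner_Integration.integral_cong) (use assms in auto)

lemma ip_commute: "ip L f g = ip L g f"
  by (simp add: ip_def mult.commute)

lemma ip_add:
  assumes "L2 L f" "L2 L g" "L2 L h"
  shows "ip L (\<lambda>x. f x + g x) h = ip L f h + ip L g h"
    and "ip L h (\<lambda>x. f x + g x) = ip L h f + ip L h g"
  using assms L2_mult_integrable by (simp_all add: ip_def distrib_left distrib_right)

lemma ip_cmult: "ip L (\<lambda>x. c * f x) h = c * ip L f h" "ip L h (\<lambda>x. c * f x) = c * ip L h f"
  by (simp_all add: ip_def mult.assoc mult.left_commute[of _ c])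

lemma ip_diff:
  assumes "L2 L f" "L2 L g" "L2 L h"
  shows "ip L (\<lambda>x. f x - g x) h = ip L f h - ip L g h"
    and "ip L h (\<lambda>x. f x - g x) = ip L h f - ip L h g"
  using assms L2_mult_integrable by (simp_all add: ip_def left_diff_distrib right_diff_distrib)

lemma ip_self_nonneg: "0 \<le> ip L f f"
  by (auto simp: ip_def intro!: Bochner_Integration.integral_nonneg)

lemma norm_L2_eq: "norm_L2 L f = sqrt (ip L f f)"
  by (simp add: norm_L2_def ip_def power2_eq_square)

lemma norm_L2_nonneg [simp]: "0 \<le> norm_L2 L f"
  by (simp add: norm_L2_eq ip_self_nonneg)

lemma norm_L2_square: "(norm_L2 L f)\<^sup>2 = ip L f f"
  by (simp add: norm_L2_eq ip_self_nonneg)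

lemma norm_L2_cong:
  assumes "\<And>x. x \<in> {0<..<L} \<Longrightarrow> f x = g x"
  shows "norm_L2 L f = norm_L2 L g"
  unfolding norm_L2_eq using assms ip_cong[of L f f g g] by simp

text \<open>Elements are functions, not classes, so \<open>ip L g g = 0\<close> does not make
  \<open>g\<close> vanish. In that case the quadratic in \<open>t\<close> is affine, and being
  bounded below forces \<open>ip L f g = 0\<close>.\<close>

lemma ip_Cauchy_Schwarz:
  assumes "L2 L f" "L2 L g"
  shows "\<bar>ip L f g\<bar> \<le> norm_L2 L f * norm_L2 L g"
proof -
  have quad: "0 \<le> ip L f f + 2 * t * ip L f g + t\<^sup>2 * ip L g g" for t
  proof -
    have "ip L (\<lambda>x. f x + t * g x) (\<lambda>x. f x + t * g x)
      = ip L f f + 2 * t * ip L f g + t\<^sup>2 * ip L g g"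
      using assms
      by (simp add: ip_add ip_cmult L2_add L2_cmult ip_commute[of L g f] power2_eq_square algebra_simps)
    then show ?thesis using ip_self_nonneg by metis
  qed
  have "(ip L f g)\<^sup>2 \<le> ip L f f * ip L g g"
  proof (cases "ip L g g = 0")
    case True
    have "ip L f g = 0"
    proof (rule ccontr)
      assume "ip L f g \<noteq> 0"
      \<comment> \<open>At this \<open>t\<close> the affine expression equals -1.\<close>
      then show False
        using quad[of "- (ip L f f + 1) / (2 * ip L f g)"] True by (simp add: field_simps)
    qed
    then show ?thesis using True by simp
  next
    case False
    then have pos: "0 < ip L g g" using ip_self_nonneg[of L g] by linarith
    \<comment> \<open>The \<open>t\<close> inserted is the minimizer of the quadratic.\<close>
    have "0 \<le> ip L f f - (ip L f g)\<^sup>2 / ip L g g"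
      using quad[of "- ip L f g / ip L g g"] pos by (simp add: power2_eq_square field_simps)
    then show ?thesis using pos by (simp add: field_simps)
  qed
  then have "\<bar>ip L f g\<bar> \<le> sqrt (ip L f f * ip L g g)"
    by (metis real_sqrt_abs real_sqrt_le_mono)
  then show ?thesis by (simp add: norm_L2_eq real_sqrt_mult)
qed

lemma LINT_eq_integral:
  fixes f :: "real \<Rightarrow> real"
  assumes "continuous_on {0..L} f"
  shows "(LINT x|lebesgue_on {0<..<L}. f x) = integral {0..L} f"
  using lebesgue_integral_eq_integral[OF integrable_continuous_Ioo[OF assms]]
  by (simp add: integral_open_interval_real)

lemma norm_L2_add_le:
  assumes "L2 L f" "L2 L g"
  shows "norm_L2 L (\<lambda>x. f x + g x) \<le> norm_L2 L f + norm_L2 L g"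
proof (rule power2_le_imp_le)
  have "(norm_L2 L (\<lambda>x. f x + g x))\<^sup>2 = (norm_L2 L f)\<^sup>2 + 2 * ip L f g + (norm_L2 L g)\<^sup>2"
    using assms by (simp add: norm_L2_square ip_add L2_add ip_commute[of L g f])
  then show "(norm_L2 L (\<lambda>x. f x + g x))\<^sup>2 \<le> (norm_L2 L f + norm_L2 L g)\<^sup>2"
    using ip_Cauchy_Schwarz[OF assms] by (simp add: power2_sum)
qed simp

lemma norm_L2_cmult: "norm_L2 L (\<lambda>x. c * f x) = \<bar>c\<bar> * norm_L2 L f"
proof -
  have "ip L (\<lambda>x. c * f x) (\<lambda>x. c * f x) = c\<^sup>2 * ip L f f"
    by (simp only: ip_cmult) (simp add: power2_eq_square)
  then show ?thesis by (simp add: norm_L2_eq real_sqrt_mult)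
qed

text \<open>The difference is expanded bilinearly around the limit, and Cauchy-Schwarz bounds each
  of the three terms. Square integrability is asked only eventually because a curve of states is
  controlled only at nonnegative times.\<close>

lemma ip_tendsto:
  assumes L2: "\<forall>\<^sub>F s in F. L2 L (f s) \<and> L2 L (g s)" "L2 L f0" "L2 L g0"
    and fl: "((\<lambda>s. norm_L2 L (\<lambda>x. f s x - f0 x)) \<longlongrightarrow> 0) F"
    and gl: "((\<lambda>s. norm_L2 L (\<lambda>x. g s x - g0 x)) \<longlongrightarrow> 0) F"
  shows "((\<lambda>s. ip L (f s) (g s)) \<longlongrightarrow> ip L f0 g0) F"
proof -
  let ?a = "\<lambda>s. norm_L2 L (\<lambda>x. f s x - f0 x)" and ?b = "\<lambda>s. norm_L2 L (\<lambda>x. g s x - g0 x)"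
  have "((\<lambda>s. ip L (f s) (g s) - ip L f0 g0) \<longlongrightarrow> 0) F"
  proof (rule Lim_null_comparison)
    show "\<forall>\<^sub>F s in F. norm (ip L (f s) (g s) - ip L f0 g0)
        \<le> ?a s * ?b s + ?a s * norm_L2 L g0 + norm_L2 L f0 * ?b s"
      using L2(1)
    proof eventually_elim
      case (elim s)
      note l2 = elim L2(2,3)
      have "ip L (f s) (g s) - ip L f0 g0 = ip L (\<lambda>x. f s x - f0 x) (\<lambda>x. g s x - g0 x)
          + ip L (\<lambda>x. f s x - f0 x) g0 + ip L f0 (\<lambda>x. g s x - g0 x)"
        using l2 by (simp add: ip_diff L2_diff)
      moreover have "\<bar>ip L (\<lambda>x. f s x - f0 x) (\<lambda>x. g s x - g0 x)\<bar> \<le> ?a s * ?b s"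
        "\<bar>ip L (\<lambda>x. f s x - f0 x) g0\<bar> \<le> ?a s * norm_L2 L g0"
        "\<bar>ip L f0 (\<lambda>x. g s x - g0 x)\<bar> \<le> norm_L2 L f0 * ?b s"
        using l2 by (auto intro!: ip_Cauchy_Schwarz L2_diff)
      ultimately show ?case by simp
    qed
    show "((\<lambda>s. ?a s * ?b s + ?a s * norm_L2 L g0 + norm_L2 L f0 * ?b s) \<longlongrightarrow> 0) F"
      using tendsto_add[OF tendsto_add[OF tendsto_mult[OF fl gl] tendsto_mult[OF fl tendsto_const]]
          tendsto_mult[OF tendsto_const gl], of "norm_L2 L g0" "norm_L2 L f0"] by simp
  qed
  then show ?thesis by (rule LIM_zero_cancel)
qed

subsection \<open>Weak and classical derivatives\<close>

text \<open>The derivative is an explicit argument, one-sided at the end points, so boundary terms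
  are plain evaluations and no choice operator enters.\<close>

definition C1_on :: "real \<Rightarrow> (real \<Rightarrow> real) \<Rightarrow> (real \<Rightarrow> real) \<Rightarrow> bool" where
  "C1_on L f f' \<longleftrightarrow>
     (\<forall>x\<in>{0..L}. (f has_real_derivative f' x) (at x within {0..L})) \<and> continuous_on {0..L} f'"

lemma C1_on_deriv:
  "C1_on L f f' \<Longrightarrow> x \<in> {0..L} \<Longrightarrow> (f has_real_derivative f' x) (at x within {0..L})"
  by (simp add: C1_on_def)

lemma C1_on_continuous: "C1_on L f f' \<Longrightarrow> continuous_on {0..L} f"
  unfolding C1_on_def by (auto intro!: DERIV_continuous_on)

lemma C1_on_continuous_deriv: "C1_on L f f' \<Longrightarrow> continuous_on {0..L} f'"
  unfolding C1_on_def by blast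

lemma C1_on_L2: "C1_on L f f' \<Longrightarrow> L2 L f" "C1_on L f f' \<Longrightarrow> L2 L f'"
  by (blast intro: L2_continuous C1_on_continuous C1_on_continuous_deriv)+

lemma C1_on_const: "C1_on L (\<lambda>_. c) (\<lambda>_. 0)"
  unfolding C1_on_def by (auto intro!: derivative_eq_intros)

lemma C1_on_id: "C1_on L (\<lambda>x. x) (\<lambda>_. 1)"
  unfolding C1_on_def by (auto intro!: derivative_eq_intros)

lemma C1_on_add: "C1_on L f f' \<Longrightarrow> C1_on L g g' \<Longrightarrow> C1_on L (\<lambda>x. f x + g x) (\<lambda>x. f' x + g' x)"
  unfolding C1_on_def by (simp add: DERIV_add continuous_on_add)

lemma C1_on_cmult: "C1_on L f f' \<Longrightarrow> C1_on L (\<lambda>x. c * f x) (\<lambda>x. c * f' x)"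
  unfolding C1_on_def by (simp add: DERIV_cmult continuous_on_mult_left)

lemma C1_on_diff: "C1_on L f f' \<Longrightarrow> C1_on L g g' \<Longrightarrow> C1_on L (\<lambda>x. f x - g x) (\<lambda>x. f' x - g' x)"
  unfolding C1_on_def by (simp add: DERIV_diff continuous_on_diff)

lemma C1_on_mult:
  assumes "C1_on L f f'" "C1_on L g g'"
  shows "C1_on L (\<lambda>x. f x * g x) (\<lambda>x. f' x * g x + f x * g' x)"
proof -
  have "continuous_on {0..L} (\<lambda>x. f' x * g x + f x * g' x)"
    using assms C1_on_continuous C1_on_continuous_deriv by (intro continuous_intros) blast+
  moreover have "((\<lambda>x. f x * g x) has_real_derivative f' x * g x + f x * g' x) (at x within {0..L})"
    if "x \<in> {0..L}" for x
    using DERIV_mult[of f "f' x" x "{0..L}" g "g' x"] assms that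
    unfolding C1_on_def by (simp add: add.commute mult.commute)
  ultimately show ?thesis unfolding C1_on_def by blast
qed

lemma C1_on_cong:
  assumes "C1_on L f f'" "\<And>x. x \<in> {0..L} \<Longrightarrow> f x = g x" "\<And>x. x \<in> {0..L} \<Longrightarrow> f' x = g' x"
  shows "C1_on L g g'"
proof -
  have "(g has_real_derivative g' x) (at x within {0..L})" if x: "x \<in> {0..L}" for x
  proof -
    have "(f has_real_derivative g' x) (at x within {0..L})"
      using assms(1,3) x unfolding C1_on_def by fastforce
    then show ?thesis
      by (rule has_field_derivative_transform_within[where d = 1]) (use assms x in auto)
  qed
  moreover have "continuous_on {0..L} g'"
    using C1_on_continuous_deriv[OF assms(1)] continuous_on_cong[of "{0..L}" "{0..L}" f' g'] assms(3) by blast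
  ultimately show ?thesis unfolding C1_on_def by blast
qed

lemma C1_on_antiderivative:
  assumes "continuous_on {0..L} g"
  shows "C1_on L (\<lambda>x. c + integral {0..x} g) g"
proof -
  have "((\<lambda>x. c + integral {0..x} g) has_real_derivative g x) (at x within {0..L})"
    if "x \<in> {0..L}" for x
    using integral_has_vector_derivative[OF assms that]
    by (auto intro!: derivative_eq_intros simp: has_real_derivative_iff_has_vector_derivative)
  then show ?thesis using assms unfolding C1_on_def by blast
qed

lemma C1_on_unique:
  assumes "0 < L" "C1_on L f f'" "C1_on L f g'" "x \<in> {0..L}"
  shows "f' x = g' x"
proof (rule vector_derivative_unique_within)
  show "at x within {0..L} \<noteq> bot"
    using assms(1,4) islimpt_Icc[of 0 L x] by (simp add: trivial_limit_within)
  show "(f has_vector_derivative f' x) (at x within {0..L})"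
    "(f has_vector_derivative g' x) (at x within {0..L})"
    using assms unfolding C1_on_def has_real_derivative_iff_has_vector_derivative by blast+
qed

lemma C1_on_FTC:
  assumes "0 < L" "C1_on L f f'"
  shows "(LINT x|lebesgue_on {0<..<L}. f' x) = f L - f 0"
proof -
  have "(f' has_integral f L - f 0) {0..L}"
    using assms unfolding C1_on_def
    by (intro fundamental_theorem_of_calculus) (auto simp: has_real_derivative_iff_has_vector_derivative)
  then show ?thesis
    using LINT_eq_integral[OF C1_on_continuous_deriv[OF assms(2)]] by (simp add: integral_unique)
qed

lemma C1_on_parts:
  assumes "0 < L" "C1_on L f f'" "C1_on L g g'"
  shows "ip L f' g + ip L f g' = f L * g L - f 0 * g 0"
proof -
  note [simp] = C1_on_L2[OF assms(2)] C1_on_L2[OF assms(3)]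
  have "ip L f' g + ip L f g' = (LINT x|lebesgue_on {0<..<L}. f' x * g x + f x * g' x)"
    by (simp add: ip_def L2_mult_integrable)
  also have "\<dots> = f L * g L - f 0 * g 0"
    using C1_on_FTC[OF assms(1) C1_on_mult[OF assms(2,3)]] by simp
  finally show ?thesis .
qed

lemma test_function_vanishes:
  assumes "test_function L p"
  shows "C1_on L p (deriv p)" "p 0 = 0" "p L = 0"
proof -
  obtain D where D: "\<And>x. (p has_vector_derivative D x) (at x)" "continuous_on UNIV D"
    using assms unfolding test_function_def C1_differentiable_on_def by blast
  then have "deriv p = D"
    by (intro ext DERIV_imp_deriv) (simp add: has_real_derivative_iff_has_vector_derivative)
  then show "C1_on L p (deriv p)"
    using D continuous_on_subset[OF D(2)] unfolding C1_on_def
    by (auto simp: has_real_derivative_iff_has_vector_derivative intro: has_vector_derivative_at_within)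
  show "p 0 = 0" "p L = 0"
    using assms unfolding test_function_def by fastforce+
qed

lemma C1_on_weak_deriv:
  assumes "0 < L" "C1_on L f f'"
  shows "weak_deriv L f f'"
  unfolding weak_deriv_def
proof (intro conjI allI impI)
  show "L2 L f" "L2 L f'" using C1_on_L2[OF assms(2)] by blast+
  fix p assume p: "test_function L p"
  show "(LINT x|lebesgue_on {0<..<L}. f x * deriv p x) =
      - (LINT x|lebesgue_on {0<..<L}. f' x * p x)"
    using C1_on_parts[OF assms test_function_vanishes(1)[OF p]] test_function_vanishes[OF p]
    unfolding ip_def by simp
qed

lemma weak_deriv_ip:
  assumes "weak_deriv L f g" "test_function L p"
  shows "ip L f (deriv p) = - ip L g p"
  using assms unfolding weak_deriv_def ip_def by blast

lemma weak_deriv_L2: "weak_deriv L f g \<Longrightarrow> L2 L f" "weak_deriv L f g \<Longrightarrow> L2 L g"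
  by (simp_all add: weak_deriv_def)

lemma test_function_L2: "test_function L p \<Longrightarrow> L2 L p" "test_function L p \<Longrightarrow> L2 L (deriv p)"
  using C1_on_L2[OF test_function_vanishes(1)] by simp_all

lemma weak_deriv_lin:
  assumes "weak_deriv L f f'" "weak_deriv L g g'"
  shows "weak_deriv L (\<lambda>x. a * f x + b * g x) (\<lambda>x. a * f' x + b * g' x)"
proof -
  note l2 = weak_deriv_L2[OF assms(1)] weak_deriv_L2[OF assms(2)]
  have "ip L (\<lambda>x. a * f x + b * g x) (deriv p) = - ip L (\<lambda>x. a * f' x + b * g' x) p"
    if p: "test_function L p" for p
    using weak_deriv_ip[OF assms(1) p] weak_deriv_ip[OF assms(2) p] test_function_L2[OF p] l2
    by (simp add: ip_add ip_cmult L2_cmult)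
  then show ?thesis
    using l2 unfolding weak_deriv_def ip_def by (simp add: L2_add L2_cmult)
qed

lemma weak_deriv_cong:
  assumes "weak_deriv L f g" "\<And>x. x \<in> {0<..<L} \<Longrightarrow> f x = f' x" "\<And>x. x \<in> {0<..<L} \<Longrightarrow> g x = g' x"
  shows "weak_deriv L f' g'"
proof -
  have L2c: "L2 L h \<longleftrightarrow> L2 L k" if "\<And>x. x \<in> {0<..<L} \<Longrightarrow> h x = k x" for h k
    unfolding L2_def using that
    by (intro conj_cong measurable_cong Bochner_Integration.integrable_cong) auto
  have "L2 L f'" "L2 L g'"
    using L2c[of f f'] L2c[of g g'] assms weak_deriv_L2[OF assms(1)] by auto
  moreover have "ip L f' (deriv p) = - ip L g' p" if "test_function L p" for p
    using weak_deriv_ip[OF assms(1) that] ip_cong[of L f "deriv p" f' "deriv p"]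
      ip_cong[of L g p g' p] assms(2,3) by simp
  ultimately show ?thesis unfolding weak_deriv_def ip_def by blast
qed

text \<open>The predicate under the choice sees only interior values of the function, so the
  selected derivatives are literally the same function, also at the end points.\<close>

lemma wderiv_cong:
  assumes "\<And>x. x \<in> {0<..<L} \<Longrightarrow> f x = g x"
  shows "wderiv L f = wderiv L g"
proof -
  have "weak_deriv L f = weak_deriv L g"
    using weak_deriv_cong[of L f _ g] weak_deriv_cong[of L g _ f] assms by (intro ext iffI) auto
  then show ?thesis unfolding wderiv_def by simp
qed

text \<open>The choice always has a witness: a continuous weak derivative if there is one; otherwise
  any weak derivative, as the implication is then vacuous.\<close>

lemma wderiv_spec:
  assumes "weak_deriv L f g"
  shows "weak_deriv L f (wderiv L f) \<and>
     ((\<exists>h. weak_deriv L f h \<and> continuous_on {0..L} h) \<longrightarrow> continuous_on {0..L} (wderiv L f))"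
proof -
  let ?P = "\<lambda>g. weak_deriv L f g \<and>
     ((\<exists>h. weak_deriv L f h \<and> continuous_on {0..L} h) \<longrightarrow> continuous_on {0..L} g)"
  have "\<exists>g. ?P g" using assms by (cases "\<exists>h. weak_deriv L f h \<and> continuous_on {0..L} h") metis+
  then have "?P (SOME g. ?P g)" by (rule someI_ex)
  then show ?thesis unfolding wderiv_def .
qed

lemma weak_deriv_wderiv: "weak_deriv L f g \<Longrightarrow> weak_deriv L f (wderiv L f)"
  using wderiv_spec by blast

lemma continuous_wderiv:
  "weak_deriv L f g \<Longrightarrow> continuous_on {0..L} g \<Longrightarrow> continuous_on {0..L} (wderiv L f)"
  using wderiv_spec by blast

subsection \<open>Integration by parts for weak derivatives\<close>

text \<open>A \<open>C\<^sup>1\<close> step from 0 to 1 on \<open>[0,2]\<close>, as a second difference of \<open>(max 0 y)\<^sup>2 / 2\<close>.\<close>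

definition step :: "real \<Rightarrow> real" where
  "step y = ((max 0 y)\<^sup>2 - 2 * (max 0 (y - 1))\<^sup>2 + (max 0 (y - 2))\<^sup>2) / 2"

text \<open>The hat function supported on [0,2], with peak 1 at 1 and integral one.\<close>

definition dstep :: "real \<Rightarrow> real" where
  "dstep y = max 0 y - 2 * max 0 (y - 1) + max 0 (y - 2)"

lemma has_real_derivative_max_0_square:
  "((\<lambda>y. (max 0 y)\<^sup>2) has_real_derivative 2 * max 0 y) (at (y::real))"
proof -
  consider "y < 0" | "y = 0" | "0 < y" by linarith
  then show ?thesis
  proof cases
    case 1
    have "((\<lambda>y. 0) has_real_derivative 0) (at y)" by simp
    then have "((\<lambda>y. (max 0 y)\<^sup>2) has_real_derivative 0) (at y)"
      by (rule has_field_derivative_transform_within_open[where S = "{..<0}"]) (use 1 in auto)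
    then show ?thesis using 1 by simp
  next
    case 2
    have "((\<lambda>h. (max 0 h)\<^sup>2 / h) \<longlongrightarrow> 0) (at (0::real))"
    proof (rule Lim_null_comparison)
      have "norm ((max 0 h)\<^sup>2 / h) \<le> \<bar>h\<bar>" for h :: real
        by (cases "h \<le> 0") (auto simp: max_def power2_eq_square abs_mult)
      then show "\<forall>\<^sub>F h in at 0. norm ((max 0 h)\<^sup>2 / h) \<le> \<bar>h\<bar>" by simp
      show "((\<lambda>h. \<bar>h\<bar>) \<longlongrightarrow> 0) (at (0::real))"
        using tendsto_rabs[OF tendsto_ident_at[of "0::real" UNIV]] by simp
    qed
    then show ?thesis using 2 by (simp add: DERIV_def)
  next
    case 3
    have "((\<lambda>y. y\<^sup>2) has_real_derivative 2 * y) (at y)"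
      by (auto intro!: derivative_eq_intros)
    then have "((\<lambda>y. (max 0 y)\<^sup>2) has_real_derivative 2 * y) (at y)"
      by (rule has_field_derivative_transform_within_open[where S = "{0<..}"]) (use 3 in auto)
    then show ?thesis using 3 by simp
  qed
qed

lemma has_real_derivative_step: "(step has_real_derivative dstep y) (at y)"
proof -
  have A: "((\<lambda>y. (max 0 (y - c))\<^sup>2) has_real_derivative 2 * max 0 (y - c)) (at y)" for c
  proof -
    have "((\<lambda>y. y - c) has_real_derivative 1) (at y)"
      by (auto intro!: derivative_eq_intros)
    then show ?thesis
      using DERIV_chain2[OF has_real_derivative_max_0_square, where g = "\<lambda>y. y - c"] by fastforce
  qed
  show ?thesis
    using DERIV_cdivide[OF DERIV_add[OF DERIV_diff[OF A[of 0] DERIV_cmult[OF A[of 1], of 2]] A[of 2]], of 2]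
    by (simp add: step_def[abs_def] dstep_def diff_divide_distrib add_divide_distrib)
qed

lemma continuous_dstep: "continuous_on S dstep"
  unfolding dstep_def[abs_def] by (intro continuous_intros)

lemma step_0: "y \<le> 0 \<Longrightarrow> step y = 0"
  by (simp add: step_def)

lemma step_1: "2 \<le> y \<Longrightarrow> step y = 1"
  by (simp add: step_def max_def power2_eq_square algebra_simps)

lemma dstep_nonneg: "0 \<le> dstep y"
  by (auto simp: dstep_def max_def)

lemma dstep_0: "y \<le> 0 \<or> 2 \<le> y \<Longrightarrow> dstep y = 0"
  by (auto simp: dstep_def max_def)

lemma step_mono: "x \<le> y \<Longrightarrow> step x \<le> step y"
  by (rule DERIV_nonneg_imp_nondecreasing) (use has_real_derivative_step dstep_nonneg in blast)+

lemma step_bounds: "0 \<le> step y" "step y \<le> 1"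
  using step_mono[of "min y 0" y] step_0[of "min y 0"] step_mono[of y "max y 2"] step_1[of "max y 2"]
  by auto

lemma has_real_derivative_step_scaled:
  assumes "d \<noteq> 0"
  shows "((\<lambda>x. step ((x - a) / d)) has_real_derivative dstep ((x - a) / d) / d) (at x)"
proof -
  have "((\<lambda>x. (x - a) / d) has_real_derivative 1 / d) (at x)"
    using assms by (auto intro!: derivative_eq_intros)
  then show ?thesis
    using DERIV_chain2[OF has_real_derivative_step, where g = "\<lambda>x. (x - a) / d"] by fastforce
qed

text \<open>The scaled hat is nonnegative and has integral one, because its primitive
  \<open>step\<close> climbs from 0 to 1 inside the interval. Pairing with it therefore averages
  \<open>k\<close> over \<open>{a..a + 2 * d}\<close>.\<close>

lemma approximate_delta:
  assumes "0 < L" "0 < d" "0 \<le> a" "a + 2 * d \<le> L"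
    and k: "continuous_on {0..L} k" and e: "\<And>x. x \<in> {a..a + 2 * d} \<Longrightarrow> \<bar>k x - k0\<bar> \<le> e"
  shows "\<bar>ip L k (\<lambda>x. dstep ((x - a) / d) / d) - k0\<bar> \<le> e"
proof -
  let ?n = "\<lambda>x. dstep ((x - a) / d) / d"
  have C1: "C1_on L (\<lambda>x. step ((x - a) / d)) ?n"
    unfolding C1_on_def using assms(2)
    by (auto intro!: has_field_derivative_at_within has_real_derivative_step_scaled
        continuous_intros continuous_on_compose2[OF continuous_dstep[of UNIV]])
  have one: "(LINT x|lebesgue_on {0<..<L}. ?n x) = 1"
    using C1_on_FTC[OF assms(1) C1] assms by (simp add: step_0 step_1 field_simps)
  have n: "L2 L ?n" and k2: "L2 L k" and c: "L2 L (\<lambda>_. k0)"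
    using C1_on_L2[OF C1] k by (auto intro: L2_continuous)
  have n0: "0 \<le> ?n x" for x using dstep_nonneg assms by simp
  have "ip L k ?n - k0 = ip L (\<lambda>x. k x - k0) ?n"
    using ip_diff(1)[OF k2 c n] one by (simp add: ip_def)
  also have "\<bar>\<dots>\<bar> \<le> (LINT x|lebesgue_on {0<..<L}. e * ?n x)"
    unfolding ip_def
  proof (rule order_trans[OF integral_abs_bound integral_mono])
    show "integrable (lebesgue_on {0<..<L}) (\<lambda>x. \<bar>(k x - k0) * ?n x\<bar>)"
      by (intro Bochner_Integration.integrable_abs L2_mult_integrable L2_diff k2 c n)
    show "integrable (lebesgue_on {0<..<L}) (\<lambda>x. e * ?n x)"
      by (intro L2_integrable L2_cmult n)
    show "\<bar>(k x - k0) * ?n x\<bar> \<le> e * ?n x" if "x \<in> space (lebesgue_on {0<..<L})" for x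
    proof (cases "x \<in> {a..a + 2 * d}")
      case True
      then show ?thesis
        using mult_right_mono[OF e[OF True] n0[of x]] assms(2) by (simp add: abs_mult dstep_nonneg)
    next
      case False
      then have "(x - a) / d \<le> 0 \<or> 2 \<le> (x - a) / d"
        using assms(2) by (auto simp: field_simps)
      then show ?thesis by (simp add: dstep_0)
    qed
  qed
  also have "\<dots> = e" using one by simp
  finally show ?thesis .
qed

text \<open>Rises between d and 3d, stays at 1 until L - 3d and is back at 0 from L - d on. The
  condition \<open>6 * d \<le> L\<close> in the lemmas below keeps these points in order.\<close>

definition cutoff :: "real \<Rightarrow> real \<Rightarrow> real \<Rightarrow> real" where
  "cutoff L d x = step ((x - d) / d) - step ((x - (L - 3 * d)) / d)"

definition dcutoff :: "real \<Rightarrow> real \<Rightarrow> real \<Rightarrow> real" where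
  "dcutoff L d x = dstep ((x - d) / d) / d - dstep ((x - (L - 3 * d)) / d) / d"

lemma has_real_derivative_cutoff:
  "d \<noteq> 0 \<Longrightarrow> (cutoff L d has_real_derivative dcutoff L d x) (at x)"
  unfolding cutoff_def[abs_def] dcutoff_def
  by (intro DERIV_diff has_real_derivative_step_scaled)

lemma continuous_dcutoff: "d \<noteq> 0 \<Longrightarrow> continuous_on S (dcutoff L d)"
  unfolding dcutoff_def[abs_def]
  by (intro continuous_intros continuous_on_compose2[OF continuous_dstep[of UNIV]]) auto

lemma continuous_cutoff: "d \<noteq> 0 \<Longrightarrow> continuous_on S (cutoff L d)"
  by (rule DERIV_continuous_on[where D = "dcutoff L d"])
    (blast intro: has_field_derivative_at_within has_real_derivative_cutoff)

lemma cutoff_eq: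
  assumes "0 < d" "6 * d \<le> L"
  shows "x \<notin> {d..L - d} \<Longrightarrow> cutoff L d x = 0" "x \<notin> {d..L - d} \<Longrightarrow> dcutoff L d x = 0"
    "x \<in> {3 * d..L - 3 * d} \<Longrightarrow> cutoff L d x = 1"
proof -
  have A: "(x - d) / d \<le> 0 \<longleftrightarrow> x \<le> d" "2 \<le> (x - d) / d \<longleftrightarrow> 3 * d \<le> x"
    "(x - (L - 3 * d)) / d \<le> 0 \<longleftrightarrow> x \<le> L - 3 * d" "2 \<le> (x - (L - 3 * d)) / d \<longleftrightarrow> L - d \<le> x"
    using assms(1) by (auto simp: field_simps)
  note B = step_0[of "(x - d) / d"] step_1[of "(x - d) / d"] dstep_0[of "(x - d) / d"]
    step_0[of "(x - (L - 3 * d)) / d"] step_1[of "(x - (L - 3 * d)) / d"]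
    dstep_0[of "(x - (L - 3 * d)) / d"]
  note B = B[unfolded A]
  have out: "x \<le> d \<and> x \<le> L - 3 * d \<or> 3 * d \<le> x \<and> L - d \<le> x" if "x \<notin> {d..L - d}"
    using that assms by auto
  show "x \<notin> {d..L - d} \<Longrightarrow> cutoff L d x = 0" "x \<notin> {d..L - d} \<Longrightarrow> dcutoff L d x = 0"
    "x \<in> {3 * d..L - 3 * d} \<Longrightarrow> cutoff L d x = 1"
    using B out unfolding cutoff_def dcutoff_def by auto
qed

lemma cutoff_bound: "\<bar>cutoff L d x\<bar> \<le> 1"
  using step_bounds[of "(x - d) / d"] step_bounds[of "(x - (L - 3 * d)) / d"]
  unfolding cutoff_def by linarith

text \<open>Since \<open>p\<close> is controlled only on \<open>{0..L}\<close>, the product is set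
  to zero outside. Differentiability is checked on two overlapping open sets that cover the line:
  the interior, and the region where the cutoff vanishes.\<close>

lemma test_function_cutoff:
  assumes d: "0 < d" "6 * d \<le> L" and p: "C1_on L p p'"
  defines "q \<equiv> \<lambda>x. if x \<in> {0<..<L} then cutoff L d x * p x else 0"
  shows "test_function L q"
    and "\<And>x. x \<in> {0<..<L} \<Longrightarrow> deriv q x = dcutoff L d x * p x + cutoff L d x * p' x"
proof -
  define D where "D = (\<lambda>x. if x \<in> {0<..<L} then dcutoff L d x * p x + cutoff L d x * p' x else 0)"
  have q0: "q x = 0" "D x = 0" if "x \<notin> {d..L - d}" for x
    using cutoff_eq[OF d] that by (auto simp: q_def D_def)
  have der: "(q has_real_derivative D x) (at x)" for x
  proof (cases "x \<in> {0<..<L}")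
    case True
    have "(p has_real_derivative p' x) (at x)"
      using C1_on_deriv[OF p, of x] True at_within_Icc_at[of 0 x L] by simp
    then have "((\<lambda>x. cutoff L d x * p x) has_real_derivative D x) (at x)"
      using DERIV_mult[OF has_real_derivative_cutoff[of d L x], of p "p' x"] d True
      by (simp add: D_def add.commute mult.commute)
    then show ?thesis
      by (rule has_field_derivative_transform_within_open[where S = "{0<..<L}"])
        (use True in \<open>auto simp: q_def\<close>)
  next
    case False
    then have x: "x \<in> - {d..L - d}" using d by auto
    have "((\<lambda>_. 0) has_real_derivative D x) (at x)" using q0(2) x by simp
    then show ?thesis
      by (rule has_field_derivative_transform_within_open[where S = "- {d..L - d}"])
        (use x q0(1) in auto)
  qed
  have "continuous_on ({0<..<L} \<union> - {d..L - d}) D"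
  proof (rule continuous_on_open_Un)
    have "continuous_on {0<..<L} (\<lambda>x. dcutoff L d x * p x + cutoff L d x * p' x)"
      using d by (intro continuous_on_add continuous_on_mult continuous_dcutoff continuous_cutoff
          continuous_on_subset[OF C1_on_continuous[OF p]]
          continuous_on_subset[OF C1_on_continuous_deriv[OF p]]) auto
    then show "continuous_on {0<..<L} D"
      by (rule continuous_on_eq) (simp add: D_def)
    show "continuous_on (- {d..L - d}) D"
      by (rule continuous_on_eq[OF continuous_on_const[where c = 0]]) (simp add: q0)
  qed auto
  moreover have "{0<..<L} \<union> - {d..L - d} = UNIV" using d by auto
  ultimately have "continuous_on UNIV D" by simp
  then have "q C1_differentiable_on UNIV"
    using der unfolding C1_differentiable_on_def has_real_derivative_iff_has_vector_derivative
    by blast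
  then show "test_function L q"
    unfolding test_function_def using q0(1) d
    by (intro conjI exI[of _ d] exI[of _ "L - d"]) auto
  show "deriv q x = dcutoff L d x * p x + cutoff L d x * p' x" if "x \<in> {0<..<L}" for x
    using DERIV_imp_deriv[OF der] that by (simp add: D_def)
qed

text \<open>Dominated convergence: each interior point eventually lies on the plateau of the cutoff,
  and the cutoff is bounded by 1.\<close>

lemma LINT_cutoff_tendsto:
  fixes h :: "real \<Rightarrow> real" and d :: "nat \<Rightarrow> real"
  assumes h: "integrable (lebesgue_on {0<..<L}) h"
    and d: "\<And>n. 0 < d n" "\<And>n. 6 * d n \<le> L" "d \<longlonglongrightarrow> 0"
  shows "(\<lambda>n. LINT x|lebesgue_on {0<..<L}. cutoff L (d n) x * h x)
    \<longlonglongrightarrow> (LINT x|lebesgue_on {0<..<L}. h x)"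
proof (rule integral_dominated_convergence[where w = "\<lambda>x. \<bar>h x\<bar>"])
  show "(\<lambda>x. cutoff L (d n) x * h x) \<in> borel_measurable (lebesgue_on {0<..<L})" for n
  proof (intro borel_measurable_times borel_measurable_integrable[OF h]
      continuous_imp_measurable_on_sets_lebesgue continuous_cutoff)
    show "d n \<noteq> 0" using d(1)[of n] by simp
  qed simp
  show "AE x in lebesgue_on {0<..<L}. norm (cutoff L (d n) x * h x) \<le> \<bar>h x\<bar>" for n
    using mult_right_mono[OF cutoff_bound[of L "d n"]] by (simp add: abs_mult)
  have "(\<lambda>n. cutoff L (d n) x * h x) \<longlonglongrightarrow> h x" if x: "x \<in> {0<..<L}" for x
  proof (rule tendsto_eventually)
    have "\<forall>\<^sub>F n in sequentially. d n < min x (L - x) / 3"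
      using x by (intro order_tendstoD(2)[OF d(3)]) auto
    then show "\<forall>\<^sub>F n in sequentially. cutoff L (d n) x * h x = h x"
      by eventually_elim (use cutoff_eq(3)[OF d(1,2)] in auto)
  qed
  then show "AE x in lebesgue_on {0<..<L}. (\<lambda>n. cutoff L (d n) x * h x) \<longlonglongrightarrow> h x"
    by (intro AE_I2) simp
qed (use h in auto)

text \<open>The test function is \<open>p\<close> times a cutoff. Differentiating the cutoff yields
  two averaging kernels of opposite sign next to 0 and \<open>L\<close>; as the cutoff widens they
  converge to the boundary terms, by continuity of \<open>f\<close>.\<close>

lemma weak_deriv_parts:
  assumes L: "0 < L" and fg: "weak_deriv L f g" "continuous_on {0..L} f" and p: "C1_on L p p'"
  shows "ip L f p' + ip L g p = f L * p L - f 0 * p 0"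
proof -
  \<comment> \<open>Any positive null sequence with \<open>6 * d n \<le> L\<close> would
    serve.\<close>
  define d where "d n = L / (6 * real (Suc n))" for n
  have d: "0 < d n" "6 * d n \<le> L" for n
    using L by (auto simp: d_def field_simps)
  have "(\<lambda>n. L / 6 * inverse (real (Suc n))) \<longlonglongrightarrow> L / 6 * 0"
    by (intro tendsto_mult_left LIMSEQ_inverse_real_of_nat)
  moreover have "d = (\<lambda>n. L / 6 * inverse (real (Suc n)))"
    by (rule ext) (simp add: d_def inverse_eq_divide)
  ultimately have d0: "d \<longlonglongrightarrow> 0" by simp
  let ?k = "\<lambda>x. f x * p x"
  let ?e = "\<lambda>n a x. dstep ((x - a) / d n) / d n"
  have k: "continuous_on {0..L} ?k"
    using fg(2) C1_on_continuous[OF p] by (intro continuous_intros)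
  have e2: "L2 L (?e n a)" for n a
    by (intro L2_continuous continuous_intros continuous_on_compose2[OF continuous_dstep[of UNIV]])
      (use d(1)[of n] in auto)
  note l2 = weak_deriv_L2[OF fg(1)] C1_on_L2[OF p] L2_continuous[OF k]
  \<comment> \<open>Here \<open>a n\<close> is the left end of the kernel's support, which shrinks
    to the boundary point \<open>b\<close>.\<close>
  have lim: "(\<lambda>n. ip L ?k (?e n (a n))) \<longlonglongrightarrow> ?k b"
    if a: "\<And>n. 0 \<le> a n" "\<And>n. a n + 2 * d n \<le> L" "a \<longlonglongrightarrow> b" and b: "b \<in> {0..L}" for a b
  proof (rule LIMSEQ_I)
    fix r :: real assume r: "0 < r"
    obtain s where s: "0 < s" "\<And>x. x \<in> {0..L} \<Longrightarrow> \<bar>x - b\<bar> < s \<Longrightarrow> \<bar>?k x - ?k b\<bar> < r / 2"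
      using k b r unfolding continuous_on_iff dist_real_def by (meson half_gt_zero)
    have "\<forall>\<^sub>F n in sequentially. \<bar>a n - b\<bar> < s / 2" "\<forall>\<^sub>F n in sequentially. d n < s / 4"
      using s(1) tendstoD[OF a(3), of "s / 2"] order_tendstoD(2)[OF d0, of "s / 4"]
      by (auto simp: dist_real_def)
    then have "\<forall>\<^sub>F n in sequentially. norm (ip L ?k (?e n (a n)) - ?k b) < r"
    proof eventually_elim
      case (elim n)
      have "\<bar>ip L ?k (?e n (a n)) - ?k b\<bar> \<le> r / 2"
      proof (rule approximate_delta[OF L d(1) a(1,2) k])
        fix x assume "x \<in> {a n..a n + 2 * d n}"
        moreover have a_close: "a n - b < s / 2" "b - a n < s / 2" using elim(1) by linarith+
        ultimately have "x \<in> {0..L}" "\<bar>x - b\<bar> < s" using a(1,2)[of n] a_close elim(2) by auto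
        then show "\<bar>?k x - ?k b\<bar> \<le> r / 2" using s(2) by fastforce
      qed
      then show ?case using r by simp
    qed
    then show "\<exists>N. \<forall>n\<ge>N. norm (ip L ?k (?e n (a n)) - ?k b) < r"
      by (simp add: eventually_sequentially)
  qed
  have lim0: "(\<lambda>n. ip L ?k (?e n (d n))) \<longlonglongrightarrow> ?k 0"
  proof (rule lim)
    show "0 \<le> d n" "d n + 2 * d n \<le> L" for n using d[of n] by linarith+
  qed (use d0 L in auto)
  have limL: "(\<lambda>n. ip L ?k (?e n (L - 3 * d n))) \<longlonglongrightarrow> ?k L"
  proof (rule lim)
    show "0 \<le> L - 3 * d n" "L - 3 * d n + 2 * d n \<le> L" for n using d[of n] by linarith+
    show "(\<lambda>n. L - 3 * d n) \<longlonglongrightarrow> L"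
      using tendsto_diff[OF tendsto_const tendsto_mult[OF tendsto_const d0], of L 3] by simp
  qed (use L in auto)
  have parts_n: "ip L ?k (?e n (d n)) - ip L ?k (?e n (L - 3 * d n))
      + (LINT x|lebesgue_on {0<..<L}. cutoff L (d n) x * (f x * p' x))
      = - (LINT x|lebesgue_on {0<..<L}. cutoff L (d n) x * (g x * p x))" for n
  proof -
    define q where "q = (\<lambda>x. if x \<in> {0<..<L} then cutoff L (d n) x * p x else 0)"
    note q = test_function_cutoff[OF d(1)[of n] d(2)[of n] p, folded q_def]
    have c2: "L2 L (\<lambda>x. cutoff L (d n) x * p' x)"
      using C1_on_continuous_deriv[OF p] d(1)[of n]
      by (intro L2_continuous continuous_on_mult continuous_cutoff) auto
    have "ip L f (deriv q) = (LINT x|lebesgue_on {0<..<L}.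
        ?k x * ?e n (d n) x - ?k x * ?e n (L - 3 * d n) x + f x * (cutoff L (d n) x * p' x))"
      unfolding ip_def
      by (intro Bochner_Integration.integral_cong refl)
        (simp add: q(2) dcutoff_def algebra_simps)
    also have "\<dots> = ip L ?k (?e n (d n)) - ip L ?k (?e n (L - 3 * d n))
      + ip L f (\<lambda>x. cutoff L (d n) x * p' x)"
      using l2(5) e2 l2(1) c2 unfolding ip_def
      by (simp only: Bochner_Integration.integral_add Bochner_Integration.integral_diff
          L2_mult_integrable Bochner_Integration.integrable_diff)
    finally have "ip L f (deriv q) = \<dots>" .
    moreover have "ip L g q = (LINT x|lebesgue_on {0<..<L}. cutoff L (d n) x * (g x * p x))"
      unfolding ip_def
      by (intro Bochner_Integration.integral_cong refl) (simp add: q_def)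
    ultimately show ?thesis
      using weak_deriv_ip[OF fg(1) q(1)] by (simp add: ip_def mult.left_commute)
  qed
  have "?k 0 - ?k L + ip L f p' = - ip L g p"
  proof (rule LIMSEQ_unique)
    show "(\<lambda>n. ip L ?k (?e n (d n)) - ip L ?k (?e n (L - 3 * d n))
      + (LINT x|lebesgue_on {0<..<L}. cutoff L (d n) x * (f x * p' x)))
      \<longlonglongrightarrow> ?k 0 - ?k L + ip L f p'"
      unfolding ip_def[of L f] using l2
      by (intro tendsto_add tendsto_diff lim0 limL LINT_cutoff_tendsto L2_mult_integrable d d0)
    have "(\<lambda>n. - (LINT x|lebesgue_on {0<..<L}. cutoff L (d n) x * (g x * p x)))
      \<longlonglongrightarrow> - ip L g p"
      unfolding ip_def using l2
      by (intro tendsto_minus LINT_cutoff_tendsto L2_mult_integrable d d0)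
    then show "(\<lambda>n. ip L ?k (?e n (d n)) - ip L ?k (?e n (L - 3 * d n))
      + (LINT x|lebesgue_on {0<..<L}. cutoff L (d n) x * (f x * p' x))) \<longlonglongrightarrow> - ip L g p"
      by (rule Lim_transform_eventually) (intro always_eventually allI parts_n[symmetric])
  qed
  then show ?thesis by simp
qed

section \<open>Vanishing weak derivatives and continuous representatives\<close>

lemma ip_self_eq_0:
  assumes "0 < L" "continuous_on {0..L} f" "ip L f f = 0" "x \<in> {0..L}"
  shows "f x = 0"
proof -
  have c: "continuous_on {0..L} (\<lambda>x. f x * f x)"
    using assms(2) by (intro continuous_intros)
  have "integral {0..L} (\<lambda>x. f x * f x) = 0"
    using LINT_eq_integral[OF c] assms(3) by (simp add: ip_def)
  then show ?thesis using integral_eq_0_iff[OF c assms(1)] assms(4) by simp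
qed

text \<open>Integration by parts against the primitive of \<open>f - f L\<close> shows that
  \<open>f\<close> and the constant \<open>f L\<close> have the same pairing with
  \<open>f - f L\<close>, so this difference is orthogonal to itself.\<close>

lemma weak_deriv_0_const:
  assumes L: "0 < L" and f: "weak_deriv L f (\<lambda>_. 0)" "continuous_on {0..L} f" and x: "x \<in> {0..L}"
  shows "f x = f L"
proof -
  let ?d = "\<lambda>x. f x - f L"
  have d: "continuous_on {0..L} ?d" using f(2) by (intro continuous_intros)
  note C = C1_on_antiderivative[OF d, of 0]
  have l2: "L2 L f" "L2 L ?d" "L2 L (\<lambda>_. f L)"
    using f(2) d by (auto intro: L2_continuous)
  have "ip L f ?d = f L * integral {0..L} ?d"
    using weak_deriv_parts[OF L f C] by (simp add: ip_def[of L "\<lambda>_. 0"])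
  also have "\<dots> = ip L (\<lambda>_. f L) ?d"
    using LINT_eq_integral[OF d] by (simp add: ip_def)
  finally have "ip L ?d ?d = 0" using ip_diff(1)[OF l2(1,3,2)] by simp
  then show ?thesis using ip_self_eq_0[OF L d _ x] by simp
qed

text \<open>Subtracting a primitive of \<open>g\<close> leaves a continuous function with vanishing
  weak derivative, hence a constant.\<close>

lemma weak_deriv_C1_on:
  assumes L: "0 < L" and fg: "weak_deriv L f g" "continuous_on {0..L} f" "continuous_on {0..L} g"
  shows "C1_on L f g"
proof -
  define Z where "Z x = 0 + integral {0..x} g" for x
  have Z: "C1_on L Z g"
    unfolding Z_def[abs_def] by (rule C1_on_antiderivative[OF fg(3)])
  have "weak_deriv L (\<lambda>x. 1 * f x + (-1) * Z x) (\<lambda>x. 1 * g x + (-1) * g x)"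
    by (rule weak_deriv_lin[OF fg(1) C1_on_weak_deriv[OF L Z]])
  then have "weak_deriv L (\<lambda>x. f x - Z x) (\<lambda>_. 0)" by simp
  moreover have "continuous_on {0..L} (\<lambda>x. f x - Z x)"
    using fg(2) C1_on_continuous[OF Z] by (intro continuous_intros)
  ultimately have eq: "f x - Z x = f L - Z L" if "x \<in> {0..L}" for x
    using weak_deriv_0_const[OF L] that by blast
  have "C1_on L (\<lambda>x. (f L - Z L) + Z x) (\<lambda>x. 0 + g x)"
    by (rule C1_on_add[OF C1_on_const Z])
  then show ?thesis
    by (rule C1_on_cong) (use eq in \<open>auto simp: algebra_simps\<close>)
qed

text \<open>Removes the choice in \<open>wderiv\<close>: for a classically differentiable function
  it returns the classical derivative on the closed interval, end points included.\<close>

lemma C1_on_wderiv: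
  assumes L: "0 < L" and f: "C1_on L f f'"
  shows "C1_on L f (wderiv L f)" and "\<And>x. x \<in> {0..L} \<Longrightarrow> wderiv L f x = f' x"
proof -
  note w = C1_on_weak_deriv[OF L f]
  show "C1_on L f (wderiv L f)"
    by (rule weak_deriv_C1_on[OF L weak_deriv_wderiv[OF w] C1_on_continuous[OF f]
          continuous_wderiv[OF w C1_on_continuous_deriv[OF f]]])
  then show "wderiv L f x = f' x" if "x \<in> {0..L}" for x
    using C1_on_unique[OF L _ f that] by blast
qed

text \<open>Subtracting a multiple of a fixed test function with mean one makes every test function the
  derivative of a test function.\<close>

lemma weak_deriv_0_const_weak:
  assumes L: "0 < L" and f: "weak_deriv L f (\<lambda>_. 0)"
  shows "\<exists>k. \<forall>p. test_function L p \<longrightarrow> ip L f p = ip L (\<lambda>_. k) p"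
proof -
  \<comment> \<open>With this \<open>d\<close> the midpoint \<open>L / 2\<close> lies on the
    plateau, so \<open>q0\<close> has nonzero integral.\<close>
  define d where "d = L / 8"
  have d: "0 < d" "6 * d \<le> L" using L by (auto simp: d_def)
  define q0 where "q0 = (\<lambda>x. if x \<in> {0<..<L} then cutoff L d x * 1 else 0)"
  have q0: "test_function L q0"
    unfolding q0_def by (rule test_function_cutoff(1)[OF d C1_on_const])
  have c_q0: "continuous_on {0..L} q0"
    by (rule C1_on_continuous[OF test_function_vanishes(1)[OF q0]])
  define m where "m = (LINT x|lebesgue_on {0<..<L}. q0 x)"
  have m: "m \<noteq> 0"
  proof
    assume "m = 0"
    then have "integral {0..L} q0 = 0" using LINT_eq_integral[OF c_q0] by (simp add: m_def)
    moreover have "0 \<le> q0 x" for x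
    proof -
      have "step ((x - (L - 3 * d)) / d) \<le> step ((x - d) / d)"
        using d by (intro step_mono divide_right_mono) auto
      then show ?thesis by (simp add: q0_def cutoff_def)
    qed
    ultimately have "\<forall>x\<in>{0..L}. q0 x = 0" using integral_eq_0_iff[OF c_q0 L] by simp
    then have "q0 (L / 2) = 0" using L by simp
    moreover have "q0 (L / 2) = 1"
      using L cutoff_eq(3)[OF d, of "L / 2"] by (simp add: q0_def d_def)
    ultimately show False by simp
  qed
  have "ip L f p = ip L (\<lambda>_. ip L f q0 / m) p" if p: "test_function L p" for p
  proof -
    \<comment> \<open>Chosen so that \<open>h\<close> has integral zero; its primitive
      \<open>H\<close> then vanishes to the right of the supports and is itself a test
      function.\<close>
    define c where "c = (LINT x|lebesgue_on {0<..<L}. p x) / m"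
    define h where "h x = p x - c * q0 x" for x
    obtain a1 b1 where p0: "0 < a1" "a1 \<le> b1" "b1 < L" "\<And>x. x \<notin> {a1..b1} \<Longrightarrow> p x = 0"
      using p unfolding test_function_def by blast
    obtain a2 b2 where q00: "0 < a2" "a2 \<le> b2" "b2 < L" "\<And>x. x \<notin> {a2..b2} \<Longrightarrow> q0 x = 0"
      using q0 unfolding test_function_def by blast
    define a where "a = min a1 a2"
    define b where "b = max b1 b2"
    have ab: "0 < a" "a \<le> b" "b < L" using p0 q00 by (auto simp: a_def b_def)
    have h0: "h x = 0" if "x \<notin> {a..b}" for x
      using that p0(4)[of x] q00(4)[of x] by (auto simp: h_def a_def b_def min_le_iff_disj le_max_iff_disj)
    have c_p: "continuous_on UNIV p" and c_q: "continuous_on UNIV q0"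
      using p q0 unfolding test_function_def
      by (auto intro: differentiable_imp_continuous_on C1_diff_imp_diff)
    have c_h: "continuous_on S h" for S
      unfolding h_def[abs_def]
      by (intro continuous_intros continuous_on_subset[OF c_p] continuous_on_subset[OF c_q]) auto
    define H where "H x = integral {0..x} h" for x
    have H0: "H x = 0" if "x \<notin> {a..b}" for x
    proof (cases "x < a")
      case True
      then have "integral {0..x} h = integral {0..x} (\<lambda>_. 0)"
        by (intro integral_cong) (use h0 in auto)
      then show ?thesis by (simp add: H_def)
    next
      case False
      then have x: "b < x" using that by auto
      have tail: "integral {0..y} h = integral {0..b} h" if "b \<le> y" for y
      proof -
        have "integral {b..y} h = integral {b..y} (\<lambda>_. 0)"
        proof (rule integral_spike)
          show "negligible {b}" by simp
          show "0 = h x" if "x \<in> {b..y} - {b}" for x using h0[of x] that by auto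
        qed
        moreover have "integral {0..b} h + integral {b..y} h = integral {0..y} h"
          by (intro Henstock_Kurzweil_Integration.integral_combine)
            (use ab that in \<open>auto intro: integrable_continuous_interval c_h\<close>)
        ultimately show ?thesis by simp
      qed
      have "integral {0..L} h = (LINT x|lebesgue_on {0<..<L}. p x - c * q0 x)"
        using LINT_eq_integral[OF c_h] by (simp add: h_def)
      also have "\<dots> = 0"
        using m by (simp add: c_def m_def L2_integrable test_function_L2 p q0)
      finally show ?thesis
        using tail[of x] tail[of L] x ab by (simp add: H_def)
    qed
    have dH: "(H has_vector_derivative h x) (at x)" for x
    proof (cases "x < a")
      case True
      have "((\<lambda>_. 0) has_vector_derivative h x) (at x)" using h0[of x] True by simp
      then show ?thesis
        by (rule has_vector_derivative_transform_within_open[where S = "{..<a}"])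
          (use H0 True in auto)
    next
      case False
      have "(H has_vector_derivative h x) (at x within {0..x + 1})"
        unfolding H_def[abs_def]
        by (rule integral_has_vector_derivative[OF c_h]) (use False ab in auto)
      then show ?thesis
        using at_within_Icc_at[of 0 x "x + 1"] False ab by simp
    qed
    have "test_function L H"
      unfolding test_function_def C1_differentiable_on_def
      using dH c_h H0 ab by blast
    moreover have "deriv H = h"
      using dH by (intro ext DERIV_imp_deriv) (simp add: has_real_derivative_iff_has_vector_derivative)
    ultimately have "ip L f h = 0"
      using weak_deriv_ip[OF f, of H] by (simp add: ip_def)
    then have "ip L f p = c * ip L f q0"
      using weak_deriv_L2(1)[OF f] test_function_L2(1)[OF p] test_function_L2(1)[OF q0]
      unfolding h_def[abs_def] by (simp add: ip_diff ip_cmult L2_cmult)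
    then show ?thesis by (simp add: ip_def c_def)
  qed
  then show ?thesis by blast
qed

text \<open>The domain asks only that \<open>u''\<close> have a weak derivative. Up to a constant,
  and in the sense of pairings, \<open>f\<close> equals a primitive of \<open>g\<close>, which is a
  continuous weak derivative of \<open>p\<close>; its existence obliges \<open>wderiv\<close> to
  select a continuous one.\<close>

lemma continuous_wderiv_of_second:
  assumes L: "0 < L" and f: "weak_deriv L p f" and g: "weak_deriv L f g" "continuous_on {0..L} g"
  shows "continuous_on {0..L} (wderiv L p)"
proof -
  define Z where "Z x = 0 + integral {0..x} g" for x
  have Z: "C1_on L Z g"
    unfolding Z_def[abs_def] by (rule C1_on_antiderivative[OF g(2)])
  have "weak_deriv L (\<lambda>x. 1 * f x + (-1) * Z x) (\<lambda>x. 1 * g x + (-1) * g x)"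
    by (rule weak_deriv_lin[OF g(1) C1_on_weak_deriv[OF L Z]])
  then have "weak_deriv L (\<lambda>x. f x - Z x) (\<lambda>_. 0)" by simp
  from weak_deriv_0_const_weak[OF L this] obtain k
    where k: "\<And>q. test_function L q \<Longrightarrow> ip L (\<lambda>x. f x - Z x) q = ip L (\<lambda>_. k) q" by blast
  have C: "continuous_on {0..L} (\<lambda>x. Z x + k)"
    using C1_on_continuous[OF Z] by (intro continuous_intros)
  have "weak_deriv L p (\<lambda>x. Z x + k)"
    unfolding weak_deriv_def ip_def[symmetric]
  proof (intro conjI allI impI)
    show "L2 L p" "L2 L (\<lambda>x. Z x + k)"
      using weak_deriv_L2[OF f] L2_continuous[OF C] by auto
    fix q assume q: "test_function L q"
    have l2: "L2 L q" "L2 L Z" "L2 L f" "L2 L (\<lambda>_. k)"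
      using test_function_L2[OF q] C1_on_L2[OF Z] weak_deriv_L2[OF g(1)]
      by (auto intro: L2_continuous)
    show "ip L p (deriv q) = - ip L (\<lambda>x. Z x + k) q"
      using k[OF q] weak_deriv_ip[OF f q] l2 by (simp add: ip_diff ip_add)
  qed
  then show ?thesis by (rule continuous_wderiv[OF _ C])
qed

subsection \<open>Sobolev, Poincare and Hardy inequalities\<close>

lemma LINT_mono_continuous:
  fixes f g :: "real \<Rightarrow> real"
  assumes "continuous_on {0..L} f" "continuous_on {0..L} g" "\<And>x. x \<in> {0<..<L} \<Longrightarrow> f x \<le> g x"
  shows "(LINT x|lebesgue_on {0<..<L}. f x) \<le> (LINT x|lebesgue_on {0<..<L}. g x)"
  using assms by (intro integral_mono integrable_continuous_Ioo) auto

lemma C1_on_subinterval: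
  assumes "C1_on L f f'" "x \<le> L"
  shows "C1_on x f f'"
  unfolding C1_on_def
proof (intro conjI ballI)
  show "continuous_on {0..x} f'"
    using C1_on_continuous_deriv[OF assms(1)] assms(2) by (auto elim: continuous_on_subset)
  show "(f has_real_derivative f' y) (at y within {0..x})" if "y \<in> {0..x}" for y
    using that assms(2)
    by (intro has_field_derivative_subset[OF C1_on_deriv[OF assms(1)]]) auto
qed

text \<open>Cauchy-Schwarz on \<open>{0..x}\<close> between \<open>e'\<close> and the constant 1.
  Keeping the integral up to \<open>x\<close> only is what gives the weighted Hardy inequality
  below.\<close>

lemma C1_on_square_bound:
  assumes e: "C1_on L e e'" "e 0 = 0" and x: "x \<in> {0..L}"
  shows "(e x)\<^sup>2 \<le> x * integral {0..x} (\<lambda>y. e' y * e' y)"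
proof (cases "x = 0")
  case True
  then show ?thesis using e(2) by simp
next
  case False
  then have x0: "0 < x" using x by simp
  have ex: "C1_on x e e'" using C1_on_subinterval[OF e(1)] x by simp
  have c: "continuous_on {0..x} (\<lambda>y. e' y * e' y)"
    using C1_on_continuous_deriv[OF ex] by (intro continuous_intros)
  have "ip x (\<lambda>_. 1) e' = e x" using C1_on_FTC[OF x0 ex] e(2) by (simp add: ip_def)
  moreover have "ip x (\<lambda>_. 1) (\<lambda>_. 1) = x"
    using LINT_eq_integral[of x "\<lambda>_. 1"] x0 by (simp add: ip_def)
  moreover have "ip x e' e' = integral {0..x} (\<lambda>y. e' y * e' y)"
    using LINT_eq_integral[OF c] by (simp add: ip_def)
  ultimately have "\<bar>e x\<bar> \<le> sqrt (x * integral {0..x} (\<lambda>y. e' y * e' y))"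
    using ip_Cauchy_Schwarz[of x "\<lambda>_. 1" e'] C1_on_L2[OF ex] L2_continuous[of x "\<lambda>_. 1"]
    by (simp add: norm_L2_eq real_sqrt_mult)
  moreover have "0 \<le> integral {0..x} (\<lambda>y. e' y * e' y)"
    using c by (intro integral_nonneg integrable_continuous_interval) auto
  ultimately show ?thesis
    using x0 by (simp add: real_le_rsqrt sqrt_le_D abs_le_square_iff[symmetric] real_sqrt_unique
        real_sqrt_le_iff flip: real_sqrt_abs)
qed

text \<open>Makes point evaluation continuous on \<open>V_space\<close>: it identifies the pointwise
  time derivative and gives meaning to the trace of the velocity at \<open>L\<close>.\<close>

lemma C1_on_sup_bound:
  assumes e: "C1_on L e e'" "e 0 = 0" and x: "x \<in> {0..L}"
  shows "\<bar>e x\<bar> \<le> sqrt L * norm_L2 L e'"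
proof -
  have c: "continuous_on S (\<lambda>y. e' y * e' y)" if "S \<subseteq> {0..L}" for S
    using continuous_on_subset[OF C1_on_continuous_deriv[OF e(1)] that] by (intro continuous_intros)
  have "(e x)\<^sup>2 \<le> x * integral {0..x} (\<lambda>y. e' y * e' y)"
    by (rule C1_on_square_bound[OF assms])
  also have "\<dots> \<le> L * integral {0..L} (\<lambda>y. e' y * e' y)"
    using x by (intro mult_mono integral_subset_le integral_nonneg integrable_continuous_interval c) auto
  also have "\<dots> = L * ip L e' e'"
    using LINT_eq_integral[OF c] by (simp add: ip_def)
  finally have "sqrt ((e x)\<^sup>2) \<le> sqrt (L * ip L e' e')" by (rule real_sqrt_le_mono)
  then show ?thesis by (simp add: norm_L2_eq real_sqrt_mult)
qed

text \<open>For \<open>k < \<pi> / (2 L)\<close> the function \<open>b x = k cot (k (x - L) + \<pi> / 2)\<close> is regular on \<open>[0,L]\<close>,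
  vanishes at \<open>L\<close> and solves \<open>b' = - k\<^sup>2 - b\<^sup>2\<close>, so that
  \<open>w'\<^sup>2 - k\<^sup>2 w\<^sup>2 = (w' - b w)\<^sup>2 + (b w\<^sup>2)'\<close>.\<close>

lemma Poincare:
  assumes L: "0 < L" and w: "C1_on L w w'" "w 0 = 0"
  shows "(pi / (2 * L))\<^sup>2 * ip L w w \<le> ip L w' w'"
proof -
  \<comment> \<open>Strict inequality matters: at the critical \<open>k\<close> the argument
    \<open>a\<close> reaches 0 at x = 0, where the cotangent is singular. The sharp constant is
    recovered by a left limit in \<open>k\<close>.\<close>
  have *: "k\<^sup>2 * ip L w w \<le> ip L w' w'" if k: "0 < k" "k < pi / (2 * L)" for k
  proof -
    define a where "a x = k * (x - L) + pi / 2" for x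
    define b where "b x = k * cot (a x)" for x
    have kL: "k * L < pi / 2" using k L by (simp add: field_simps)
    have s: "sin (a x) \<noteq> 0" if "x \<in> {0..L}" for x
    proof -
      have "k * (x - L) \<le> 0" "k * (x - L) \<ge> - (k * L)"
        using that k L by (simp_all add: mult_le_0_iff algebra_simps)
      then have "0 < a x" "a x < pi" using kL pi_gt_zero by (auto simp: a_def)
      then show ?thesis using sin_gt_zero by force
    qed
    have db: "(b has_real_derivative - k\<^sup>2 - (b x)\<^sup>2) (at x within {0..L})" if x: "x \<in> {0..L}" for x
    proof -
      have "(a has_real_derivative k) (at x within {0..L})"
        unfolding a_def[abs_def] by (auto intro!: derivative_eq_intros)
      from DERIV_cmult[OF DERIV_chain2[OF DERIV_cot[OF s[OF x]] this], of k]
      have "(b has_real_derivative k * (- inverse ((sin (a x))\<^sup>2) * k)) (at x within {0..L})"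
        by (simp add: b_def[abs_def])
      moreover have "inverse ((sin (a x))\<^sup>2) = 1 + (cot (a x))\<^sup>2"
        using s[OF x] by (simp add: cot_def field_simps)
      ultimately show ?thesis by (simp add: b_def algebra_simps power2_eq_square)
    qed
    have cb: "continuous_on {0..L} b" by (rule DERIV_continuous_on[OF db])
    have b: "C1_on L b (\<lambda>x. - k\<^sup>2 - (b x)\<^sup>2)"
      unfolding C1_on_def using db cb by (auto intro!: continuous_intros)
    have bw: "C1_on L (\<lambda>x. b x * (w x * w x))
        (\<lambda>x. (- k\<^sup>2 - (b x)\<^sup>2) * (w x * w x) + b x * (w' x * w x + w x * w' x))"
      by (rule C1_on_mult[OF b C1_on_mult[OF w(1) w(1)]])
    note cw = C1_on_continuous[OF w(1)] C1_on_continuous_deriv[OF w(1)]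
    have "b L = 0" by (simp add: b_def a_def cot_def)
    then have "0 = (LINT x|lebesgue_on {0<..<L}.
        (- k\<^sup>2 - (b x)\<^sup>2) * (w x * w x) + b x * (w' x * w x + w x * w' x))"
      using C1_on_FTC[OF L bw] w(2) by simp
    also have "\<dots> \<le> (LINT x|lebesgue_on {0<..<L}. w' x * w' x - k\<^sup>2 * (w x * w x))"
    proof (rule LINT_mono_continuous)
      show "(- k\<^sup>2 - (b x)\<^sup>2) * (w x * w x) + b x * (w' x * w x + w x * w' x)
          \<le> w' x * w' x - k\<^sup>2 * (w x * w x)" for x
        using zero_le_power2[of "w' x - b x * w x"] by (simp add: power2_eq_square algebra_simps)
    qed (use cw C1_on_continuous_deriv[OF bw] in \<open>auto intro!: continuous_intros\<close>)
    also have "\<dots> = ip L w' w' - k\<^sup>2 * ip L w w"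
      using C1_on_L2[OF w(1)] by (simp add: ip_def L2_mult_integrable)
    finally show ?thesis by simp
  qed
  have "((\<lambda>k. k\<^sup>2 * ip L w w) \<longlongrightarrow> (pi / (2 * L))\<^sup>2 * ip L w w) (at_left (pi / (2 * L)))"
    by (intro tendsto_intros)
  moreover have "0 < pi / (2 * L)" using L by simp
  then have "\<forall>\<^sub>F k in at_left (pi / (2 * L)). k\<^sup>2 * ip L w w \<le> ip L w' w'"
    using eventually_at_left[of 0 "pi / (2 * L)"] * by auto
  ultimately show ?thesis
    by (intro tendsto_upperbound) (auto simp: trivial_limit_at_left_real)
qed

text \<open>Let W(x) be the integral of w^2 over [0,x]. Then z^2 is at most x W, so the integrand 2
  z^2 + x^2 w^2 is at most (x^2 W)', which integrates to L^2 W(L).\<close>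

lemma Hardy_weighted:
  assumes L: "0 < L" and z: "C1_on L z w" "z 0 = 0"
  shows "2 * ip L z z \<le> L\<^sup>2 * ip L w w - ip L (\<lambda>x. x * w x) (\<lambda>x. x * w x)"
proof -
  define W where "W x = 0 + integral {0..x} (\<lambda>y. w y * w y)" for x
  note cw = C1_on_continuous_deriv[OF z(1)] C1_on_continuous[OF z(1)]
  have W: "C1_on L W (\<lambda>y. w y * w y)"
    unfolding W_def[abs_def] by (rule C1_on_antiderivative) (intro continuous_intros cw)
  have D: "C1_on L (\<lambda>x. (x * x) * W x) (\<lambda>x. (1 * x + x * 1) * W x + (x * x) * (w x * w x))"
    by (intro C1_on_mult C1_on_id W)
  have l2: "L2 L z" "L2 L (\<lambda>x. x * w x)"
    using cw by (auto intro!: L2_continuous continuous_intros)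
  have "2 * ip L z z + ip L (\<lambda>x. x * w x) (\<lambda>x. x * w x)
      = (LINT x|lebesgue_on {0<..<L}. 2 * (z x * z x) + x * w x * (x * w x))"
    using l2 by (simp add: ip_def L2_mult_integrable)
  also have "\<dots> \<le> (LINT x|lebesgue_on {0<..<L}. (1 * x + x * 1) * W x + (x * x) * (w x * w x))"
  proof (rule LINT_mono_continuous)
    show "2 * (z x * z x) + x * w x * (x * w x) \<le> (1 * x + x * 1) * W x + (x * x) * (w x * w x)"
      if "x \<in> {0<..<L}" for x
      using C1_on_square_bound[OF z, of x] that by (simp add: W_def power2_eq_square algebra_simps)
  qed (use cw C1_on_continuous_deriv[OF D] in \<open>auto intro!: continuous_intros\<close>)
  also have "\<dots> = L\<^sup>2 * W L" using C1_on_FTC[OF L D] by (simp add: power2_eq_square)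
  also have "W L = ip L w w"
    using LINT_eq_integral[of L "\<lambda>y. w y * w y"] cw(1) by (simp add: W_def ip_def continuous_intros)
  finally show ?thesis by simp
qed

subsection \<open>The elliptic problem\<close>

text \<open>Solving the last equation for \<open>u2\<close> gives
  \<open>u2 = - w / C + P / C * u\<close>. So J w is the second derivative of the elliptic solution,
  and the last argument stands for J w throughout.\<close>

definition elliptic_bvp ::
  "real \<Rightarrow> real \<Rightarrow> real \<Rightarrow> (real \<Rightarrow> real) \<Rightarrow> (real \<Rightarrow> real) \<Rightarrow> (real \<Rightarrow> real) \<Rightarrow> (real \<Rightarrow> real) \<Rightarrow> bool"
  where
  "elliptic_bvp L C P w u u1 u2 \<longleftrightarrow> C1_on L u u1 \<and> C1_on L u1 u2 \<and> u 0 = 0 \<and> u1 L = 0 \<and>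
     (\<forall>x\<in>{0..L}. w x = - C * u2 x + P * u x)"

text \<open>Variation of constants for u'' = r^2 u - w / C. An actual solution is required before
  the choice in \<open>elliptic_inv\<close> can be exploited.\<close>

lemma elliptic_bvp_exists:
  assumes "0 < L" "0 < C" "0 < P" and w: "continuous_on {0..L} w"
  shows "\<exists>u u1 u2. elliptic_bvp L C P w u u1 u2"
proof -
  define r where "r = sqrt (P / C)"
  have r: "0 < r" "r\<^sup>2 = P / C" using assms by (simp_all add: r_def)
  define ch where "ch x = cosh (r * x)" for x
  define sh where "sh x = sinh (r * x)" for x
  have ch: "C1_on L ch (\<lambda>x. r * sh x)" and sh: "C1_on L sh (\<lambda>x. r * ch x)"
    unfolding C1_on_def ch_def[abs_def] sh_def[abs_def]
    by (auto intro!: derivative_eq_intros continuous_intros)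
  have hyp: "ch x * ch x - sh x * sh x = 1" for x
    using hyperbolic_pythagoras[of "r * x"] by (simp add: ch_def sh_def power2_eq_square)
  \<comment> \<open>The kernel sinh(r (x - y)) = sinh(r x) cosh(r y) - cosh(r x) sinh(r y) is split,
    so that each integrand depends on y alone.\<close>
  define S where "S x = 0 + integral {0..x} (\<lambda>y. ch y * w y)" for x
  define K where "K x = 0 + integral {0..x} (\<lambda>y. sh y * w y)" for x
  have S: "C1_on L S (\<lambda>x. ch x * w x)" and K: "C1_on L K (\<lambda>x. sh x * w x)"
    unfolding S_def[abs_def] K_def[abs_def]
    by (intro C1_on_antiderivative continuous_intros w C1_on_continuous[OF ch]
        C1_on_continuous[OF sh])+
  \<comment> \<open>The homogeneous solution \<open>sh\<close> already vanishes at 0; its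
    coefficient is fixed by \<open>u1 L = 0\<close>.\<close>
  define A where "A = (ch L * S L - sh L * K L) / (C * r * ch L)"
  have chL: "ch L \<noteq> 0" using cosh_real_pos[of "r * L"] by (simp add: ch_def)
  define u where "u x = A * sh x - 1 / (C * r) * (sh x * S x - ch x * K x)" for x
  define u1 where "u1 x = A * r * ch x - 1 / C * (ch x * S x - sh x * K x)" for x
  define u2 where "u2 x = (P * u x - w x) / C" for x
  have "C1_on L u (\<lambda>x. A * (r * ch x) - 1 / (C * r) * ((r * ch x * S x + sh x * (ch x * w x))
      - (r * sh x * K x + ch x * (sh x * w x))))"
    unfolding u_def[abs_def] by (intro C1_on_diff C1_on_cmult C1_on_mult sh ch S K)
  then have u: "C1_on L u u1"
    by (rule C1_on_cong) (use r assms in \<open>simp_all add: u1_def field_simps\<close>)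
  have "C1_on L u1 (\<lambda>x. A * r * (r * sh x) - 1 / C * ((r * sh x * S x + ch x * (ch x * w x))
      - (r * ch x * K x + sh x * (sh x * w x))))"
    unfolding u1_def[abs_def] by (intro C1_on_diff C1_on_cmult C1_on_mult sh ch S K)
  then have u1: "C1_on L u1 u2"
  proof (rule C1_on_cong)
    fix x
    have "A * r * (r * sh x) - 1 / C * ((r * sh x * S x + ch x * (ch x * w x))
        - (r * ch x * K x + sh x * (sh x * w x)))
      = r\<^sup>2 * u x - 1 / C * (ch x * ch x - sh x * sh x) * w x"
      using r(1) assms(2) by (simp add: u_def power2_eq_square field_simps)
    also have "\<dots> = u2 x"
      unfolding hyp r(2) u2_def using assms(2) by (simp add: field_simps)
    finally show "A * r * (r * sh x) - 1 / C * ((r * sh x * S x + ch x * (ch x * w x))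
        - (r * ch x * K x + sh x * (sh x * w x))) = u2 x" .
  qed simp
  have "u 0 = 0" by (simp add: u_def sh_def S_def K_def)
  moreover have "u1 L = 0" using chL r assms(2) by (simp add: u1_def A_def)
  moreover have "w x = - C * u2 x + P * u x" for x
    using assms(2) by (simp add: u2_def)
  ultimately show ?thesis using u u1 unfolding elliptic_bvp_def by blast
qed

lemma weak_deriv_cong_AE:
  assumes "weak_deriv L f g" "L2 L h" "AE x in lebesgue_on {0<..<L}. g x = h x"
  shows "weak_deriv L f h"
proof -
  have "ip L g p = ip L h p" if p: "test_function L p" for p
    unfolding ip_def
  proof (rule Bochner_Integration.integral_cong_AE)
    show "AE x in lebesgue_on {0<..<L}. g x * p x = h x * p x"
      using assms(3) by eventually_elim simp
    show "(\<lambda>x. g x * p x) \<in> borel_measurable (lebesgue_on {0<..<L})"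
      "(\<lambda>x. h x * p x) \<in> borel_measurable (lebesgue_on {0<..<L})"
      using test_function_L2(1)[OF p] weak_deriv_L2(2)[OF assms(1)] assms(2)
      by (auto simp: L2_def)
  qed
  then show ?thesis using assms(1,2) unfolding weak_deriv_def ip_def by auto
qed

text \<open>The chosen \<open>elliptic_inv\<close> solves the equation only almost everywhere. But J
  w is by definition a continuous combination of it and \<open>w\<close>, and agrees almost
  everywhere with its weak second derivative, so the solution is in fact classical.\<close>

lemma J_elliptic_bvp:
  assumes L: "0 < L" and "0 < C" "0 < P" and w: "continuous_on {0..L} w"
  obtains u u1 where "elliptic_bvp L C P w u u1 (J L C P w)"
proof -
  let ?P = "\<lambda>u. u \<in> dom_Dx2 L \<and>
     (AE x in lebesgue_on {0<..<L}. - C * wderivs L 2 u x + P * u x = w x)"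
  have two: "wderivs L 2 v = wderiv L (wderiv L v)" for v by (simp add: numeral_2_eq_2)
  obtain v v1 v2 where v: "elliptic_bvp L C P w v v1 v2"
    using elliptic_bvp_exists[OF assms] by blast
  then have C1: "C1_on L v v1" "C1_on L v1 v2" unfolding elliptic_bvp_def by auto
  note v1 = C1_on_wderiv[OF L C1(1)]
  have w2: "C1_on L (wderiv L v) v2"
    by (rule C1_on_cong[OF C1(2)]) (use v1(2) in auto)
  note v2 = C1_on_wderiv[OF L w2]
  have "H2 L v"
    unfolding H2_def H1_def
    using C1_on_continuous[OF v1(1)] C1_on_weak_deriv[OF L v1(1)]
      C1_on_continuous[OF v2(1)] C1_on_weak_deriv[OF L v2(1)] by blast
  then have "?P v"
    using v v1(2) v2(2) L unfolding dom_Dx2_def elliptic_bvp_def two by (auto intro!: AE_I2)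
  then have "?P (elliptic_inv L C P w)" unfolding elliptic_inv_def by (rule someI[of ?P])
  then obtain u where u: "u = elliptic_inv L C P w" "?P u" by simp
  have Jw: "J L C P w = (\<lambda>x. (P * u x - w x) / C)"
    by (simp add: J_def u(1) diff_divide_distrib)
  have wd: "weak_deriv L u (wderiv L u)" "weak_deriv L (wderiv L u) (wderivs L 2 u)"
    "continuous_on {0..L} u" "continuous_on {0..L} (wderiv L u)" "u 0 = 0" "wderiv L u L = 0"
    using u(2) unfolding dom_Dx2_def H2_def H1_def two by (auto intro: weak_deriv_wderiv)
  have cJ: "continuous_on {0..L} (J L C P w)"
    unfolding Jw using wd(3) w assms(2) by (intro continuous_intros) auto
  have "AE x in lebesgue_on {0<..<L}. wderivs L 2 u x = J L C P w x"
    using u(2) assms(2) by (auto simp: Jw field_simps elim!: eventually_mono)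
  then have "weak_deriv L (wderiv L u) (J L C P w)"
    by (rule weak_deriv_cong_AE[OF wd(2) L2_continuous[OF cJ]])
  then have "C1_on L (wderiv L u) (J L C P w)"
    by (rule weak_deriv_C1_on[OF L _ wd(4) cJ])
  moreover have "C1_on L u (wderiv L u)" by (rule weak_deriv_C1_on[OF L wd(1,3,4)])
  ultimately have "elliptic_bvp L C P w u (wderiv L u) (J L C P w)"
    unfolding elliptic_bvp_def using wd(5,6) assms(2) by (simp add: Jw)
  then show thesis by (rule that)
qed

lemma elliptic_bvp_C1_on:
  assumes "0 < C" and e: "elliptic_bvp L C P w u u1 j" and w: "C1_on L w w2"
  shows "C1_on L j (\<lambda>x. (P * u1 x - w2 x) / C)"
proof -
  have "C1_on L (\<lambda>x. P / C * u x - 1 / C * w x) (\<lambda>x. P / C * u1 x - 1 / C * w2 x)"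
    using e unfolding elliptic_bvp_def by (intro C1_on_diff C1_on_cmult w) auto
  then show ?thesis
    by (rule C1_on_cong) (use e assms(1) in \<open>auto simp: elliptic_bvp_def field_simps\<close>)
qed

lemma elliptic_bvp_L2:
  assumes "elliptic_bvp L C P w u u1 j"
  shows "L2 L u" "L2 L u1" "L2 L j"
  using assms C1_on_L2[of L u u1] C1_on_L2[of L u1 j] by (auto simp: elliptic_bvp_def)

text \<open>Insert w' = - C v'' + P v and integrate by parts; the boundary terms vanish by v(0) = 0
  and u'(L) = 0. The right side is symmetric, and nonpositive on the diagonal when \<open>C\<close>
  and \<open>P\<close> are positive, which gives both properties of J.\<close>

lemma elliptic_bvp_ip:
  assumes L: "0 < L" and e: "elliptic_bvp L C P w u u1 j" and f: "elliptic_bvp L C P w' v v1 k"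
  shows "ip L j w' = - C * ip L j k - P * ip L u1 v1"
proof -
  note l2 = elliptic_bvp_L2[OF e] elliptic_bvp_L2[OF f]
  have "ip L j v + ip L u1 v1 = u1 L * v L - u1 0 * v 0"
    using e f unfolding elliptic_bvp_def by (intro C1_on_parts L) auto
  then have jv: "ip L j v = - ip L u1 v1"
    using e f unfolding elliptic_bvp_def by simp
  have "ip L j w' = ip L j (\<lambda>x. - C * k x + P * v x)"
    using f unfolding elliptic_bvp_def by (intro ip_cong) auto
  also have "\<dots> = - C * ip L j k + P * ip L j v"
    using l2 by (simp add: ip_add ip_diff ip_cmult L2_cmult del: mult_minus_left)
  finally show ?thesis using jv by simp
qed

lemma elliptic_bvp_symmetric:
  assumes "0 < L" "elliptic_bvp L C P w u u1 j" "elliptic_bvp L C P w' v v1 k"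
  shows "ip L j w' = ip L k w"
  using elliptic_bvp_ip[OF assms] elliptic_bvp_ip[OF assms(1,3,2)] by (simp add: ip_commute)

lemma elliptic_bvp_norm:
  assumes L: "0 < L" and e: "elliptic_bvp L C P w u u1 j"
  shows "ip L w w = C\<^sup>2 * ip L j j + 2 * C * P * ip L u1 u1 + P\<^sup>2 * ip L u u"
proof -
  note l2 = elliptic_bvp_L2[OF e]
  have "ip L j u + ip L u1 u1 = u1 L * u L - u1 0 * u 0"
    using e unfolding elliptic_bvp_def by (intro C1_on_parts L) auto
  then have ju: "ip L j u = - ip L u1 u1"
    using e unfolding elliptic_bvp_def by simp
  have "ip L w w = ip L (\<lambda>x. P * u x - C * j x) (\<lambda>x. P * u x - C * j x)"
    using e unfolding elliptic_bvp_def by (intro ip_cong) auto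
  also have "\<dots> = C\<^sup>2 * ip L j j - 2 * C * P * ip L j u + P\<^sup>2 * ip L u u"
    using l2 by (simp add: ip_diff ip_cmult L2_cmult L2_diff ip_commute[of L u j] power2_eq_square
        algebra_simps)
  finally show ?thesis using ju by simp
qed

lemma elliptic_bvp_diff:
  assumes "elliptic_bvp L C P w u u1 j" "elliptic_bvp L C P w' v v1 k"
  shows "elliptic_bvp L C P (\<lambda>x. w x - w' x) (\<lambda>x. u x - v x) (\<lambda>x. u1 x - v1 x) (\<lambda>x. j x - k x)"
  using assms unfolding elliptic_bvp_def by (auto intro!: C1_on_diff simp: right_diff_distrib)

text \<open>Drops the nonnegative terms in \<open>u\<close> and \<open>u1\<close> of
  \<open>elliptic_bvp_norm\<close>. Applied to differences it yields continuity in time of J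
  z'.\<close>

lemma elliptic_bvp_bounded:
  assumes "0 < L" "0 < C" "0 < P" "elliptic_bvp L C P w u u1 j"
  shows "norm_L2 L j \<le> norm_L2 L w / C"
proof -
  have "C\<^sup>2 * ip L j j \<le> ip L w w"
    using elliptic_bvp_norm[OF assms(1,4)] ip_self_nonneg[of L u] ip_self_nonneg[of L u1] assms
    by simp
  then have "sqrt (C\<^sup>2 * ip L j j) \<le> sqrt (ip L w w)" by (rule real_sqrt_le_mono)
  then show ?thesis
    using assms(2) by (simp add: norm_L2_eq real_sqrt_mult field_simps)
qed

text \<open>Both estimates compare \<open>-J\<close> with its value on the lowest eigenfunction of \<open>-D\<^sub>x\<^sup>2\<close>, whose
  eigenvalue is \<open>(\<pi> / (2 L))\<^sup>2\<close>.\<close>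

lemma elliptic_bvp_lower:
  assumes L: "0 < L" and "0 < C" "0 < P" and e: "elliptic_bvp L C P w u u1 j"
  defines "\<mu> \<equiv> (pi / (2 * L))\<^sup>2"
  shows "\<mu> * ip L w w \<le> (C * \<mu> + P) * (C * ip L j j + P * ip L u1 u1)"
proof -
  note l2 = elliptic_bvp_L2[OF e]
  have \<mu>_nonneg: "0 \<le> \<mu>" by (simp add: \<mu>_def)
  have uu: "\<mu> * ip L u u \<le> ip L u1 u1"
    unfolding \<mu>_def using e unfolding elliptic_bvp_def by (intro Poincare L) auto
  have "ip L j u + ip L u1 u1 = u1 L * u L - u1 0 * u 0"
    using e unfolding elliptic_bvp_def by (intro C1_on_parts L) auto
  then have ju: "ip L j u = - ip L u1 u1"
    using e unfolding elliptic_bvp_def by simp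
  \<comment> \<open>Since j = u'', this sum would vanish on the lowest eigenfunction. Its
    nonnegativity lifts the Poincare inequality from the pair (u, u') to the pair (u', u'').\<close>
  have "0 \<le> ip L (\<lambda>x. j x + \<mu> * u x) (\<lambda>x. j x + \<mu> * u x)" by (rule ip_self_nonneg)
  also have "\<dots> = ip L j j - 2 * \<mu> * ip L u1 u1 + \<mu> * (\<mu> * ip L u u)"
    using l2 by (simp add: ip_add ip_cmult L2_cmult L2_add ip_commute[of L u j] ju algebra_simps)
  also have "\<dots> \<le> ip L j j - 2 * \<mu> * ip L u1 u1 + \<mu> * ip L u1 u1"
    using mult_left_mono[OF uu \<mu>_nonneg] by simp
  finally have jj: "\<mu> * ip L u1 u1 \<le> ip L j j" by simp
  have "C * P * (\<mu> * ip L u1 u1) \<le> C * P * ip L j j" "P\<^sup>2 * (\<mu> * ip L u u) \<le> P\<^sup>2 * ip L u1 u1"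
    using jj uu assms(2,3) by (intro mult_left_mono; simp)+
  then show ?thesis
    unfolding elliptic_bvp_norm[OF L e] by (simp add: algebra_simps power2_eq_square)
qed

lemma elliptic_bvp_upper:
  assumes L: "0 < L" and C: "0 < C" and P: "0 < P" and e: "elliptic_bvp L C P w u u1 j"
    and w: "C1_on L w w2" "w 0 = 0"
  shows "C * (C * (pi / (2 * L))\<^sup>2 + P) * ip L j j \<le> ip L w2 w2"
proof -
  define j1 where "j1 = (\<lambda>x. (P * u1 x - w2 x) / C)"
  have j: "C1_on L j j1" unfolding j1_def by (rule elliptic_bvp_C1_on[OF C e w(1)])
  have u1: "C1_on L u1 j" "u1 L = 0" using e by (auto simp: elliptic_bvp_def)
  have "w 0 = - C * j 0 + P * u 0" "u 0 = 0" using e L by (auto simp: elliptic_bvp_def)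
  \<comment> \<open>At 0 both \<open>w\<close> and \<open>u\<close> vanish, hence so does J w; this
    admits J w to the Poincare inequality.\<close>
  then have j0: "j 0 = 0" using w(2) C by simp
  have l2: "L2 L u1" "L2 L j1" using C1_on_L2[OF j] C1_on_L2[OF u1(1)] by auto
  have u1j1: "ip L u1 j1 = - ip L j j"
    using C1_on_parts[OF L u1(1) j] u1(2) j0 by simp
  have "ip L w2 w2 = ip L (\<lambda>x. P * u1 x - C * j1 x) (\<lambda>x. P * u1 x - C * j1 x)"
    using C by (intro ip_cong) (simp add: j1_def)
  also have "\<dots> = P\<^sup>2 * ip L u1 u1 + 2 * C * P * ip L j j + C\<^sup>2 * ip L j1 j1"
    using l2 by (simp add: ip_diff ip_cmult L2_cmult L2_diff ip_commute[of L j1 u1] u1j1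
        power2_eq_square algebra_simps)
  finally have eq: "ip L w2 w2 = P\<^sup>2 * ip L u1 u1 + 2 * C * P * ip L j j + C\<^sup>2 * ip L j1 j1" .
  have "C\<^sup>2 * ((pi / (2 * L))\<^sup>2 * ip L j j) \<le> C\<^sup>2 * ip L j1 j1"
    using Poincare[OF L j j0] by (intro mult_left_mono) auto
  moreover have "0 \<le> P\<^sup>2 * ip L u1 u1" "0 \<le> C * P * ip L j j"
    using C P ip_self_nonneg by auto
  ultimately have "C\<^sup>2 * ((pi / (2 * L))\<^sup>2 * ip L j j) + C * P * ip L j j \<le> ip L w2 w2"
    using eq by linarith
  then show ?thesis by (simp add: algebra_simps power2_eq_square)
qed

subsection \<open>Regularity of states in the domain\<close>

lemma V_spaceD:
  assumes L: "0 < L" and v: "v \<in> V_space L"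
  shows "C1_on L v (wderiv L v)" "v 0 = 0" "wderiv L v 0 = 0"
    "weak_deriv L (wderiv L v) (wderivs L 2 v)"
proof -
  have two: "wderivs L 2 v = wderiv L (wderiv L v)" by (simp add: numeral_2_eq_2)
  have c: "continuous_on {0..L} v" "continuous_on {0..L} (wderiv L v)" "weak_deriv L v (wderiv L v)"
    using v unfolding V_space_def H2_def H1_def by (auto intro: weak_deriv_wderiv)
  show "C1_on L v (wderiv L v)" by (rule weak_deriv_C1_on[OF L c(3,1,2)])
  show "v 0 = 0" "wderiv L v 0 = 0" using v by (auto simp: V_space_def)
  show "weak_deriv L (wderiv L v) (wderivs L 2 v)"
    using v unfolding V_space_def H2_def H1_def two by (auto intro: weak_deriv_wderiv)
qed

text \<open>Regularity is gained from the top down: continuity of the flux and of J z' gives z'''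
  continuous, then z'' is continuous, and only then are the derivatives classical. The last weak
  derivative follows since J z' is now C^1.\<close>

lemma D_spaceD:
  assumes L: "0 < L" and C: "0 < C" and P: "0 < P" and d: "(z, v) \<in> D_space L B C P"
  shows "z \<in> V_space L" "v \<in> V_space L"
    "C1_on L (wderiv L z) (wderivs L 2 z)" "C1_on L (wderivs L 2 z) (wderivs L 3 z)"
    "weak_deriv L (wderivs L 3 z) (wderivs L 4 z)"
    "wderivs L 2 z L = 0" "wderivs L 3 z L + B\<^sup>2 * J L C P (wderiv L z) L = 0"
proof -
  have n: "wderivs L 2 z = wderiv L (wderiv L z)" "wderivs L 3 z = wderiv L (wderivs L 2 z)"
    "wderivs L 4 z = wderiv L (wderivs L 3 z)"
    by (simp_all add: numeral_2_eq_2 numeral_3_eq_3 eval_nat_numeral)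
  show V: "z \<in> V_space L" "v \<in> V_space L"
    "wderivs L 2 z L = 0" "wderivs L 3 z L + B\<^sup>2 * J L C P (wderiv L z) L = 0"
    using d by (auto simp: D_space_def H_space_def flux_def)
  note z = V_spaceD[OF L V(1)]
  note cw = C1_on_continuous_deriv[OF z(1)]
  obtain u u1 where e: "elliptic_bvp L C P (wderiv L z) u u1 (J L C P (wderiv L z))"
    by (rule J_elliptic_bvp[OF L C P cw])
  have cJ: "continuous_on {0..L} (J L C P (wderiv L z))"
    using e by (auto simp: elliptic_bvp_def intro: C1_on_continuous_deriv)
  obtain g where g: "continuous_on {0..L} (flux L B C P z)" "weak_deriv L (flux L B C P z) g"
    using d by (auto simp: D_space_def H1_def)
  have w3: "wderivs L 3 z = (\<lambda>x. 1 * flux L B C P z x + (- B\<^sup>2) * J L C P (wderiv L z) x)"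
    by (simp add: flux_def)
  have c3: "continuous_on {0..L} (wderivs L 3 z)"
    unfolding w3 using g(1) cJ by (intro continuous_intros)
  have wd3: "weak_deriv L (wderivs L 2 z) (wderivs L 3 z)"
    using d unfolding n(2) by (auto simp: D_space_def intro: weak_deriv_wderiv)
  have c2: "continuous_on {0..L} (wderivs L 2 z)"
    unfolding n(1) by (rule continuous_wderiv_of_second[OF L z(4) wd3 c3])
  show w: "C1_on L (wderiv L z) (wderivs L 2 z)" by (rule weak_deriv_C1_on[OF L z(4) cw c2])
  show "C1_on L (wderivs L 2 z) (wderivs L 3 z)" by (rule weak_deriv_C1_on[OF L wd3 c2 c3])
  have "weak_deriv L (wderivs L 3 z) (\<lambda>x. 1 * g x
      + (- B\<^sup>2) * ((P * u1 x - wderivs L 2 z x) / C))"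
    unfolding w3 by (rule weak_deriv_lin[OF g(2) C1_on_weak_deriv[OF L elliptic_bvp_C1_on[OF C e w]]])
  then show "weak_deriv L (wderivs L 3 z) (wderivs L 4 z)"
    unfolding n(3) by (rule weak_deriv_wderiv)
qed

subsection \<open>The multiplier method\<close>

definition beam_energy :: "real \<Rightarrow> real \<Rightarrow> real \<Rightarrow> real \<Rightarrow> (real \<Rightarrow> real) \<Rightarrow> (real \<Rightarrow> real) \<Rightarrow> real" where
  "beam_energy L B C P z v = 1 / 2 * (ip L v v + ip L (wderivs L 2 z) (wderivs L 2 z)
     - B\<^sup>2 * ip L (J L C P (wderiv L z)) (wderiv L z))"

text \<open>Weak form of the equation. The boundary term at \<open>L\<close> carries the factor z'''
  + B^2 J z', which vanishes there by the natural boundary condition; the one at 0 is removed by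
  \<open>p 0 = 0\<close>.\<close>

lemma acceleration_parts:
  assumes L: "0 < L" and C: "0 < C" and P: "0 < P" and d: "(z, v) \<in> D_space L B C P"
    and a: "L2 L a"
    and pde: "AE x in lebesgue_on {0<..<L}.
      a x + wderivs L 4 z x + B\<^sup>2 * wderiv L (J L C P (wderiv L z)) x = 0"
    and p: "C1_on L p p'" "p 0 = 0"
  shows "ip L a p = ip L (wderivs L 3 z) p' + B\<^sup>2 * ip L (J L C P (wderiv L z)) p'"
proof -
  note z = V_spaceD[OF L D_spaceD(1)[OF L C P d]] and D = D_spaceD(3-)[OF L C P d]
  let ?j = "J L C P (wderiv L z)"
  obtain u u1 where e: "elliptic_bvp L C P (wderiv L z) u u1 ?j"
    by (rule J_elliptic_bvp[OF L C P C1_on_continuous_deriv[OF z(1)]])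
  note j = elliptic_bvp_C1_on[OF C e D(1)]
  have dj: "C1_on L ?j (wderiv L ?j)" by (rule C1_on_wderiv[OF L j])
  have w4: "ip L (wderivs L 3 z) p' + ip L (wderivs L 4 z) p = wderivs L 3 z L * p L"
    using weak_deriv_parts[OF L D(3) C1_on_continuous_deriv[OF D(2)] p(1)] p(2) by simp
  have j1: "ip L ?j p' + ip L (wderiv L ?j) p = ?j L * p L"
    using weak_deriv_parts[OF L C1_on_weak_deriv[OF L dj] C1_on_continuous[OF dj] p(1)] p(2) by simp
  note l2 = C1_on_L2[OF p(1)] C1_on_L2[OF dj] weak_deriv_L2[OF D(3)]
  have "ip L a p = ip L (\<lambda>x. (-1) * wderivs L 4 z x + (- B\<^sup>2) * wderiv L ?j x) p"
    unfolding ip_def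
  proof (rule Bochner_Integration.integral_cong_AE)
    show "(\<lambda>x. a x * p x) \<in> borel_measurable (lebesgue_on {0<..<L})"
      "(\<lambda>x. ((-1) * wderivs L 4 z x + (- B\<^sup>2) * wderiv L ?j x) * p x)
        \<in> borel_measurable (lebesgue_on {0<..<L})"
      by (rule borel_measurable_integrable[OF L2_mult_integrable];
          intro a l2 L2_add L2_cmult)+
    show "AE x in lebesgue_on {0<..<L}.
        a x * p x = ((-1) * wderivs L 4 z x + (- B\<^sup>2) * wderiv L ?j x) * p x"
      using pde
    proof eventually_elim
      case (elim x)
      then have "a x = (-1) * wderivs L 4 z x + (- B\<^sup>2) * wderiv L ?j x" by linarith
      then show ?case by (rule arg_cong)
    qed
  qed
  also have "\<dots> = (-1) * ip L (wderivs L 4 z) p + (- B\<^sup>2) * ip L (wderiv L ?j) p"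
    using l2 by (simp only: ip_add ip_cmult L2_cmult)
  also have "\<dots> = ip L (wderivs L 3 z) p' + B\<^sup>2 * ip L ?j p'
      - (wderivs L 3 z L + B\<^sup>2 * ?j L) * p L"
  proof -
    have "ip L (wderivs L 4 z) p = wderivs L 3 z L * p L - ip L (wderivs L 3 z) p'"
      "ip L (wderiv L ?j) p = ?j L * p L - ip L ?j p'"
      using w4 j1 by linarith+
    then show ?thesis by (simp only:) (simp add: algebra_simps)
  qed
  finally show ?thesis using D(5) by simp
qed

text \<open>Test the equation with \<open>v\<close> and move one derivative between z''' and v'; the
  boundary terms vanish by v'(0) = 0 and z''(L) = 0.\<close>

lemma energy_rate_zero:
  assumes L: "0 < L" and C: "0 < C" and P: "0 < P" and d: "(z, v) \<in> D_space L B C P"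
    and a: "L2 L a"
    and pde: "AE x in lebesgue_on {0<..<L}.
      a x + wderivs L 4 z x + B\<^sup>2 * wderiv L (J L C P (wderiv L z)) x = 0"
  shows "ip L a v + ip L (wderivs L 2 z) (wderivs L 2 v)
    - B\<^sup>2 * ip L (J L C P (wderiv L z)) (wderiv L v) = 0"
proof -
  note D = D_spaceD(3-)[OF L C P d] and v = V_spaceD[OF L D_spaceD(2)[OF L C P d]]
  have "ip L (wderiv L v) (wderivs L 3 z) + ip L (wderivs L 2 v) (wderivs L 2 z) = 0"
    using weak_deriv_parts[OF L v(4) C1_on_continuous_deriv[OF v(1)] D(2)] v(3) D(4) by simp
  then show ?thesis
    using acceleration_parts[OF L C P d a pde v(1,2)] by (simp add: ip_commute)
qed

text \<open>Both integrands are x (f^2)' / 2.\<close>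

lemma ip_radial:
  assumes L: "0 < L" and f: "C1_on L f f'"
  shows "ip L f (\<lambda>x. x * f' x) = (L * (f L)\<^sup>2 - ip L f f) / 2"
    and "ip L f' (\<lambda>x. x * f x) = (L * (f L)\<^sup>2 - ip L f f) / 2"
proof -
  have xf: "C1_on L (\<lambda>x. x * f x) (\<lambda>x. 1 * f x + x * f' x)"
    by (rule C1_on_mult[OF C1_on_id f])
  have l2: "L2 L f" "L2 L (\<lambda>x. x * f' x)"
    using C1_on_continuous[OF f] C1_on_continuous_deriv[OF f]
    by (auto intro!: L2_continuous continuous_intros)
  have sw: "ip L f' (\<lambda>x. x * f x) = ip L f (\<lambda>x. x * f' x)"
    by (rule ip_cong) simp
  show 1: "ip L f (\<lambda>x. x * f' x) = (L * (f L)\<^sup>2 - ip L f f) / 2"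
    using C1_on_parts[OF L f xf] l2 sw by (simp add: ip_add power2_eq_square algebra_simps)
  show "ip L f' (\<lambda>x. x * f x) = (L * (f L)\<^sup>2 - ip L f f) / 2"
    using 1 sw by simp
qed

definition weight :: "real \<Rightarrow> real \<Rightarrow> real \<Rightarrow> real \<Rightarrow> real" where
  "weight L B C P = 1 / (1 + B\<^sup>2 / (C * (pi / (2 * L))\<^sup>2 + P))"

text \<open>The third claim is the balance that fixes the weight: it serves both the absorption in
  \<open>multiplier_rate\<close> and the gain in \<open>beam_energy_lower\<close>.\<close>

lemma weight_bounds:
  assumes "0 < C" "0 < P"
  shows "0 < weight L B C P" "weight L B C P \<le> 1"
    "(1 - weight L B C P) * (C * (pi / (2 * L))\<^sup>2 + P) = weight L B C P * B\<^sup>2"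
proof -
  let ?q = "C * (pi / (2 * L))\<^sup>2 + P"
  have q: "0 < ?q" using assms by (intro add_nonneg_pos) auto
  have s: "0 \<le> B\<^sup>2 / ?q" using q by (intro divide_nonneg_pos) auto
  then show "0 < weight L B C P" "weight L B C P \<le> 1" by (simp_all add: weight_def)
  have "1 - 1 / (1 + s) = 1 / (1 + s) * s" if "0 \<le> s" for s :: real
    using that by (simp add: field_simps)
  from this[OF s] have "1 - weight L B C P = weight L B C P * (B\<^sup>2 / ?q)"
    unfolding weight_def .
  then show "(1 - weight L B C P) * ?q = weight L B C P * B\<^sup>2"
    using q by simp
qed

definition multiplier :: "real \<Rightarrow> real \<Rightarrow> (real \<Rightarrow> real) \<Rightarrow> real \<Rightarrow> real" where
  "multiplier L k z = (\<lambda>x. x * wderiv L z x - k / 2 * z x)"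

lemma multiplier_rate:
  assumes L: "0 < L" and C: "0 < C" and P: "0 < P" and d: "(z, v) \<in> D_space L B C P"
    and a: "L2 L a"
    and pde: "AE x in lebesgue_on {0<..<L}.
      a x + wderivs L 4 z x + B\<^sup>2 * wderiv L (J L C P (wderiv L z)) x = 0"
  defines "k \<equiv> weight L B C P"
  shows "ip L a (multiplier L k z) + ip L v (multiplier L k v)
    \<le> L / 2 * (v L)\<^sup>2 - (1 + k) * beam_energy L B C P z v"
proof -
  note z = V_spaceD[OF L D_spaceD(1)[OF L C P d]] and D = D_spaceD(3-)[OF L C P d]
    and v = V_spaceD[OF L D_spaceD(2)[OF L C P d]]
  let ?w = "wderiv L z" and ?w2 = "wderivs L 2 z" and ?w3 = "wderivs L 3 z" and ?v1 = "wderiv L v"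
  let ?j = "J L C P ?w"
  obtain u u1 where e: "elliptic_bvp L C P ?w u u1 ?j"
    by (rule J_elliptic_bvp[OF L C P C1_on_continuous_deriv[OF z(1)]])
  define j1 where "j1 = (\<lambda>x. (P * u1 x - ?w2 x) / C)"
  have j: "C1_on L ?j j1" unfolding j1_def by (rule elliptic_bvp_C1_on[OF C e D(1)])
  have u1: "C1_on L u1 ?j" "u1 L = 0" using e by (auto simp: elliptic_bvp_def)
  have xw: "C1_on L (\<lambda>x. x * ?w x) (\<lambda>x. 1 * ?w x + x * ?w2 x)"
    by (rule C1_on_mult[OF C1_on_id D(1)])
  have M: "C1_on L (multiplier L k z) (\<lambda>x. (1 * ?w x + x * ?w2 x) - k / 2 * ?w x)"
    unfolding multiplier_def by (intro C1_on_diff C1_on_cmult xw z(1))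
  have M0: "multiplier L k z 0 = 0" by (simp add: multiplier_def z(2))
  have cx: "L2 L (\<lambda>x. x * f x)" if "continuous_on {0..L} f" for f
    using that by (intro L2_continuous continuous_intros)
  note c = C1_on_continuous[OF v(1)] C1_on_continuous_deriv[OF v(1)] C1_on_continuous[OF D(1)]
    C1_on_continuous[OF D(2)] C1_on_continuous_deriv[OF D(2)] C1_on_continuous[OF j]
    C1_on_continuous_deriv[OF j] C1_on_continuous[OF u1(1)]
  note l2 = c[THEN L2_continuous] c[THEN cx]
  have split: "ip L f (\<lambda>x. (1 * ?w x + x * ?w2 x) - k / 2 * ?w x)
      = (1 - k / 2) * ip L f ?w + ip L f (\<lambda>x. x * ?w2 x)" if "L2 L f" for f
    using l2 that by (simp only: ip_diff ip_add ip_cmult L2_cmult L2_add mult_1)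
      (simp add: algebra_simps)
  have t1: "ip L ?w3 ?w = - ip L ?w2 ?w2"
    using C1_on_parts[OF L D(2,1)] z(3) D(4) by simp
  have t2: "ip L ?w3 (\<lambda>x. x * ?w2 x) = - ip L ?w2 ?w2 / 2"
    using ip_radial(2)[OF L D(2)] D(4) by simp
  have t3: "ip L ?j ?w = - C * ip L ?j ?j - P * ip L u1 u1"
    by (rule elliptic_bvp_ip[OF L e e])
  have w2: "?w2 x = P * u1 x - C * j1 x" for x using C by (simp add: j1_def)
  \<comment> \<open>J z' and z'' are not a function and its derivative, so the radial identity does
    not apply directly. Writing z'' = P u' - C (Jz')' and using Jz' = (u')' gives two pairings to
    which it does.\<close>
  have "ip L ?j (\<lambda>x. x * ?w2 x) = ip L ?j (\<lambda>x. P * (x * u1 x) - C * (x * j1 x))"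
    by (intro ip_cong) (simp add: w2 algebra_simps)
  also have "\<dots> = P * ip L ?j (\<lambda>x. x * u1 x) - C * ip L ?j (\<lambda>x. x * j1 x)"
    using l2 by (simp add: ip_diff ip_cmult L2_cmult)
  also have "\<dots> = - P / 2 * ip L u1 u1 - C / 2 * (L * (?j L)\<^sup>2 - ip L ?j ?j)"
    using ip_radial(1)[OF L j] ip_radial(2)[OF L u1(1)] u1(2) by simp
  \<comment> \<open>The discarded boundary term with (Jz')(L)^2 has a favourable sign.\<close>
  also have "\<dots> \<le> - P / 2 * ip L u1 u1 + C / 2 * ip L ?j ?j"
    using C L by (simp add: algebra_simps)
  finally have t4: "ip L ?j (\<lambda>x. x * ?w2 x) \<le> - P / 2 * ip L u1 u1 + C / 2 * ip L ?j ?j" .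
  have "ip L v (multiplier L k v) = ip L v (\<lambda>x. x * ?v1 x) - k / 2 * ip L v v"
    unfolding multiplier_def using l2 by (simp only: ip_diff ip_cmult L2_cmult)
  then have t5: "ip L v (multiplier L k v) = (L * (v L)\<^sup>2 - ip L v v) / 2 - k / 2 * ip L v v"
    using ip_radial(1)[OF L v(1)] by simp
  have "ip L a (multiplier L k z)
      = (1 - k / 2) * ip L ?w3 ?w + ip L ?w3 (\<lambda>x. x * ?w2 x)
        + B\<^sup>2 * ((1 - k / 2) * ip L ?j ?w + ip L ?j (\<lambda>x. x * ?w2 x))"
    using acceleration_parts[OF L C P d a pde M M0] l2 by (simp only: split)
  also have "\<dots> \<le> - (3 - k) / 2 * ip L ?w2 ?w2
      + B\<^sup>2 * ((1 - k / 2) * ip L ?j ?w + (- P / 2 * ip L u1 u1 + C / 2 * ip L ?j ?j))"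
    unfolding t1 t2 using mult_left_mono[OF t4, of "B\<^sup>2"] by (simp add: field_simps)
  finally have rate: "ip L a (multiplier L k z) \<le> - (3 - k) / 2 * ip L ?w2 ?w2
      + B\<^sup>2 * ((1 - k / 2) * ip L ?j ?w + (- P / 2 * ip L u1 u1 + C / 2 * ip L ?j ?j))" .
  note kb = weight_bounds[OF C P, of L B, folded k_def]
  have "(1 - k) * (C * (C * (pi / (2 * L))\<^sup>2 + P) * ip L ?j ?j) \<le> (1 - k) * ip L ?w2 ?w2"
    using elliptic_bvp_upper[OF L C P e D(1) z(3)] kb(2) by (intro mult_left_mono) auto
  moreover have "(1 - k) * (C * (C * (pi / (2 * L))\<^sup>2 + P) * ip L ?j ?j)
      = ((1 - k) * (C * (pi / (2 * L))\<^sup>2 + P)) * (C * ip L ?j ?j)" by simp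
  ultimately have "k * B\<^sup>2 * (C * ip L ?j ?j) \<le> (1 - k) * ip L ?w2 ?w2"
    unfolding kb(3) by simp
  moreover have "0 \<le> (1 - k) * (B\<^sup>2 * (P * ip L u1 u1))"
    using kb(2) P ip_self_nonneg by simp
  ultimately have gap: "0 \<le> (1 - k) * ip L ?w2 ?w2 - k * B\<^sup>2 * (C * ip L ?j ?j)
      + (1 - k) * (B\<^sup>2 * (P * ip L u1 u1))" by linarith
  \<comment> \<open>Collecting coefficients: the velocity terms cancel, and what remains is exactly
    the quantity shown nonnegative in \<open>gap\<close>.\<close>
  have "(L / 2 * (v L)\<^sup>2 - (1 + k) * beam_energy L B C P z v)
      - ((- (3 - k) / 2 * ip L ?w2 ?w2
          + B\<^sup>2 * ((1 - k / 2) * ip L ?j ?w + (- P / 2 * ip L u1 u1 + C / 2 * ip L ?j ?j)))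
        + ip L v (multiplier L k v))
    = (1 - k) * ip L ?w2 ?w2 - k * B\<^sup>2 * (C * ip L ?j ?j) + (1 - k) * (B\<^sup>2 * (P * ip L u1 u1))"
    unfolding t5 beam_energy_def t3 by (simp add: field_simps)
  then show ?thesis using rate gap by linarith
qed

text \<open>The left side is split into shares 1 - k and k. The first is paid by the J part of the
  potential energy through the elliptic lower bound, the second by z'' through Poincare; the weight
  identity gives both the common factor k.\<close>

lemma beam_energy_lower:
  assumes L: "0 < L" and C: "0 < C" and P: "0 < P" and d: "(z, v) \<in> D_space L B C P"
  shows "(pi / (2 * L))\<^sup>2 * ip L (wderiv L z) (wderiv L z)
    \<le> weight L B C P * (2 * beam_energy L B C P z v - ip L v v)"
proof -
  note z = V_spaceD[OF L D_spaceD(1)[OF L C P d]] and D = D_spaceD(3-)[OF L C P d]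
  let ?w = "wderiv L z" and ?w2 = "wderivs L 2 z" and ?\<mu> = "(pi / (2 * L))\<^sup>2"
  let ?j = "J L C P ?w" and ?q = "C * (pi / (2 * L))\<^sup>2 + P" and ?k = "weight L B C P"
  obtain u u1 where e: "elliptic_bvp L C P ?w u u1 ?j"
    by (rule J_elliptic_bvp[OF L C P C1_on_continuous_deriv[OF z(1)]])
  let ?Q = "C * ip L ?j ?j + P * ip L u1 u1"
  have q: "0 < ?q" using C P by (intro add_nonneg_pos) auto
  have N: "2 * beam_energy L B C P z v - ip L v v = ip L ?w2 ?w2 + B\<^sup>2 * ?Q"
    unfolding beam_energy_def elliptic_bvp_ip[OF L e e] by (simp add: algebra_simps)
  note kb = weight_bounds[OF C P, of L B]
  have "(1 - ?k) * (?\<mu> * ip L ?w ?w) \<le> (1 - ?k) * (?q * ?Q)"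
    using elliptic_bvp_lower[OF L C P e] kb(2) by (intro mult_left_mono) auto
  also have "\<dots> = ?k * (B\<^sup>2 * ?Q)" using kb(3) by (simp only: mult.assoc[symmetric])
  finally have "(1 - ?k) * (?\<mu> * ip L ?w ?w) \<le> ?k * (B\<^sup>2 * ?Q)" .
  moreover have "?k * (?\<mu> * ip L ?w ?w) \<le> ?k * ip L ?w2 ?w2"
    using Poincare[OF L D(1) z(3)] kb(1) by (intro mult_left_mono) auto
  ultimately have "(1 - ?k) * (?\<mu> * ip L ?w ?w) + ?k * (?\<mu> * ip L ?w ?w)
      \<le> ?k * (B\<^sup>2 * ?Q) + ?k * ip L ?w2 ?w2" by (rule add_mono)
  then show ?thesis unfolding N by (simp add: algebra_simps)
qed

text \<open>The cross term is evaluated by \<open>ip_radial\<close>: its boundary part is dropped,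
  and the rest leaves the coefficient k / 2 + k^2 / 4 of the squared norm of z, within the 2 offered
  by the Hardy inequality.\<close>

lemma multiplier_norm:
  assumes L: "0 < L" and z: "C1_on L z (wderiv L z)" "z 0 = 0" and k: "0 \<le> k" "k \<le> 1"
  shows "ip L (multiplier L k z) (multiplier L k z) \<le> L\<^sup>2 * ip L (wderiv L z) (wderiv L z)"
proof -
  let ?w = "wderiv L z"
  have l2: "L2 L z" "L2 L (\<lambda>x. x * ?w x)"
    using C1_on_continuous[OF z(1)] C1_on_continuous_deriv[OF z(1)]
    by (auto intro!: L2_continuous continuous_intros)
  have "ip L (multiplier L k z) (multiplier L k z)
      = ip L (\<lambda>x. x * ?w x) (\<lambda>x. x * ?w x) - k * ip L z (\<lambda>x. x * ?w x) + k\<^sup>2 / 4 * ip L z z"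
    unfolding multiplier_def
    using l2 ip_commute[of L z "\<lambda>x. x * ?w x"]
    by (simp only: ip_diff ip_cmult L2_cmult L2_diff) (simp add: power2_eq_square field_simps)
  also have "\<dots> = ip L (\<lambda>x. x * ?w x) (\<lambda>x. x * ?w x) - k / 2 * L * (z L)\<^sup>2
      + (k / 2 + k\<^sup>2 / 4) * ip L z z"
    unfolding ip_radial(1)[OF L z(1)] by (simp add: field_simps)
  also have "\<dots> \<le> ip L (\<lambda>x. x * ?w x) (\<lambda>x. x * ?w x) - 0 + 2 * ip L z z"
  proof (intro add_mono diff_mono mult_right_mono order_refl ip_self_nonneg)
    have "k\<^sup>2 \<le> 1" using k by (simp add: power_le_one)
    then show "k / 2 + k\<^sup>2 / 4 \<le> 2" using k by simp
    show "0 \<le> k / 2 * L * (z L)\<^sup>2" using k L by simp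
  qed
  also have "\<dots> \<le> L\<^sup>2 * ip L ?w ?w" using Hardy_weighted[OF L z] by simp
  finally show ?thesis .
qed

lemma multiplier_bound:
  assumes L: "0 < L" and C: "0 < C" and P: "0 < P" and d: "(z, v) \<in> D_space L B C P"
  defines "k \<equiv> weight L B C P"
  shows "\<bar>ip L v (multiplier L k z)\<bar> \<le> (1 + k) * (L\<^sup>2 / pi) * beam_energy L B C P z v"
    and "0 \<le> beam_energy L B C P z v"
proof -
  note z = V_spaceD[OF L D_spaceD(1)[OF L C P d]] and v = V_spaceD[OF L D_spaceD(2)[OF L C P d]]
  note kb = weight_bounds[OF C P, of L B, folded k_def]
  let ?w = "wderiv L z" and ?M = "multiplier L k z" and ?E = "beam_energy L B C P z v"
  \<comment> \<open>Twice the potential energy, so that E is the mean of \<open>N\<close> and the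
    squared velocity norm.\<close>
  define N where "N = 2 * ?E - ip L v v"
  have \<mu>: "(pi / (2 * L))\<^sup>2 * ip L ?w ?w \<le> k * N"
    using beam_energy_lower[OF L C P d] by (simp add: k_def N_def)
  then have N: "0 \<le> N"
    using kb(1) ip_self_nonneg[of L ?w]
    by (metis mult_nonneg_nonneg order_trans zero_le_mult_iff zero_le_power2 not_le)
  show "0 \<le> ?E" using N ip_self_nonneg[of L v] by (simp add: N_def)
  have "ip L ?M ?M \<le> L\<^sup>2 * ip L ?w ?w"
    using multiplier_norm[OF L z(1,2), of k] kb by simp
  \<comment> \<open>Extracts the Poincare constant, so that the bound by \<open>k * N\<close> can be
    inserted.\<close>
  also have "\<dots> = (L\<^sup>2 / pi)\<^sup>2 * (4 * ((pi / (2 * L))\<^sup>2 * ip L ?w ?w))"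
    using L by (simp add: power2_eq_square field_simps)
  also have "\<dots> \<le> (L\<^sup>2 / pi)\<^sup>2 * (4 * (k * N))"
    using \<mu> by (intro mult_left_mono) auto
  also have "\<dots> \<le> (L\<^sup>2 / pi)\<^sup>2 * ((1 + k)\<^sup>2 * N)"
  proof -
    have "4 * k \<le> (1 + k)\<^sup>2"
      using zero_le_power2[of "1 - k"] by (simp add: power2_eq_square algebra_simps)
    then show ?thesis using mult_right_mono[OF _ N] by (intro mult_left_mono) fastforce+
  qed
  finally have "sqrt (ip L ?M ?M) \<le> sqrt ((L\<^sup>2 / pi)\<^sup>2 * ((1 + k)\<^sup>2 * N))"
    by (rule real_sqrt_le_mono)
  also have "\<dots> = (L\<^sup>2 / pi) * (1 + k) * sqrt N"
    using kb(1) by (simp add: real_sqrt_mult)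
  finally have sM: "sqrt (ip L ?M ?M) \<le> (L\<^sup>2 / pi) * (1 + k) * sqrt N" .
  have l2: "L2 L v" "L2 L ?M"
    using C1_on_continuous[OF z(1)] C1_on_continuous_deriv[OF z(1)] C1_on_L2[OF v(1)]
    unfolding multiplier_def by (auto intro!: L2_continuous continuous_intros)
  have "\<bar>ip L v ?M\<bar> \<le> sqrt (ip L v v) * sqrt (ip L ?M ?M)"
    using ip_Cauchy_Schwarz[OF l2] by (simp add: norm_L2_eq)
  also have "\<dots> \<le> sqrt (ip L v v) * ((L\<^sup>2 / pi) * (1 + k) * sqrt N)"
    using sM by (intro mult_left_mono) (auto simp: ip_self_nonneg)
  also have "\<dots> = (1 + k) * (L\<^sup>2 / pi) * sqrt (ip L v v * N)"
    by (simp add: real_sqrt_mult)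
  also have "\<dots> \<le> (1 + k) * (L\<^sup>2 / pi) * ((ip L v v + N) / 2)"
    using arith_geo_mean_sqrt[OF ip_self_nonneg N] kb(1) by (intro mult_left_mono) auto
  finally show "\<bar>ip L v ?M\<bar> \<le> (1 + k) * (L\<^sup>2 / pi) * ?E" by (simp add: N_def)
qed

subsection \<open>Time derivatives along a solution\<close>

lemma norm_H2_ge:
  "norm_L2 L u \<le> norm_H2 L u" "norm_L2 L (wderiv L u) \<le> norm_H2 L u"
  "norm_L2 L (wderivs L 2 u) \<le> norm_H2 L u"
  unfolding norm_H2_def by (rule real_le_rsqrt; simp)+

lemma norm_H2_nonneg [simp]: "0 \<le> norm_H2 L u"
  by (simp add: norm_H2_def)

lemma norm_H_ge: "norm_H2 L (fst w) \<le> norm_H L w" "norm_L2 L (snd w) \<le> norm_H L w"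
  unfolding norm_H_def case_prod_unfold by (rule real_le_rsqrt; simp)+

text \<open>The first component of the generator is the velocity, so the graph norm contains its
  \<open>norm_H2\<close>.\<close>

lemma norm_D_ge: "norm_H L w \<le> norm_D L B C P w" "norm_H2 L (snd w) \<le> norm_D L B C P w"
proof -
  show "norm_H L w \<le> norm_D L B C P w"
    unfolding norm_D_def by (rule real_le_rsqrt) simp
  have "norm_H2 L (snd w) \<le> norm_H L (generator L B C P w)"
    using norm_H_ge(1)[of L "generator L B C P w"] by (simp add: generator_def case_prod_unfold)
  also have "\<dots> \<le> norm_D L B C P w"
    unfolding norm_D_def by (rule real_le_rsqrt) simp
  finally show "norm_H2 L (snd w) \<le> norm_D L B C P w" .
qed

lemma tendsto_0_norm_L2:
  assumes "(g \<longlongrightarrow> 0) F" "\<forall>\<^sub>F s in F. norm_L2 L (f s) \<le> g s"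
  shows "((\<lambda>s. norm_L2 L (f s)) \<longlongrightarrow> 0) F"
  by (rule Lim_null_comparison[OF _ assms(1)]) (use assms(2) in simp)

text \<open>Weak derivatives are determined only up to null sets, so those without a continuous
  representative are compared through pairings.\<close>

lemma weak_deriv_ip_unique:
  assumes "0 < L" "weak_deriv L f g" "weak_deriv L f h" "continuous_on {0..L} f" "C1_on L p p'"
  shows "ip L g p = ip L h p"
  using weak_deriv_parts[OF assms(1,2,4,5)] weak_deriv_parts[OF assms(1,3,4,5)] by simp

lemma norm_L2_times_id:
  assumes "0 < L" "L2 L f"
  shows "L2 L (\<lambda>x. x * f x)" "norm_L2 L (\<lambda>x. x * f x) \<le> L * norm_L2 L f"
proof -
  have le: "(x * f x)\<^sup>2 \<le> L\<^sup>2 * (f x)\<^sup>2" if "x \<in> {0<..<L}" for x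
    using that by (simp add: power_mult_distrib mult_right_mono power_mono)
  have i: "integrable (lebesgue_on {0<..<L}) (\<lambda>x. L\<^sup>2 * (f x)\<^sup>2)"
    using assms(2) by (simp add: L2_def)
  have m: "(\<lambda>x. x * f x) \<in> borel_measurable (lebesgue_on {0<..<L})"
    using assms(2) L2_continuous[of L "\<lambda>x. x"] by (auto simp: L2_def)
  have i2: "integrable (lebesgue_on {0<..<L}) (\<lambda>x. (x * f x)\<^sup>2)"
    by (rule Bochner_Integration.integrable_bound[OF i])
      (use m le in \<open>auto intro!: AE_I2\<close>)
  show l2: "L2 L (\<lambda>x. x * f x)" using m i2 by (simp add: L2_def)
  have "(LINT x|lebesgue_on {0<..<L}. (x * f x)\<^sup>2) \<le> (LINT x|lebesgue_on {0<..<L}. L\<^sup>2 * (f x)\<^sup>2)"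
    by (rule integral_mono[OF i2 i]) (use le in auto)
  then have "sqrt (LINT x|lebesgue_on {0<..<L}. (x * f x)\<^sup>2)
      \<le> sqrt (L\<^sup>2 * (LINT x|lebesgue_on {0<..<L}. (f x)\<^sup>2))"
    by (simp add: real_sqrt_le_mono)
  then show "norm_L2 L (\<lambda>x. x * f x) \<le> L * norm_L2 L f"
    using assms(1) by (simp add: norm_L2_def real_sqrt_mult)
qed

lemma at_within_Ici_nontrivial:
  assumes "0 \<le> t"
  shows "at t within {0..} \<noteq> (bot :: real filter)"
proof
  assume "at t within {0..} = (bot :: real filter)"
  moreover have "at_right t \<le> at t within {0..}"
    using assms by (intro at_le) auto
  ultimately have "at_right t \<le> bot" by simp
  from le_bot[OF this] show False using trivial_limit_at_right_real[of t] by blast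
qed

text \<open>Here \<open>w'\<close> is the derivative of the state in the norm of
  \<open>H_space\<close>; its link with the pointwise derivative \<open>zdot\<close> is proved
  below.\<close>

locale beam_curve =
  fixes L B C P :: real and z :: "real \<Rightarrow> real \<Rightarrow> real" and w' :: "real \<Rightarrow> state"
  assumes L: "0 < L" and C: "0 < C" and P: "0 < P"
    and dom: "\<And>t. 0 \<le> t \<Longrightarrow> (z t, zdot z t) \<in> D_space L B C P"
    and cont: "\<And>t. 0 \<le> t \<Longrightarrow>
      ((\<lambda>s. norm_D L B C P (state_diff (z s, zdot z s) (z t, zdot z t))) \<longlongrightarrow> 0)
        (at t within {0..})"
    and rate_dom: "\<And>t. 0 \<le> t \<Longrightarrow> w' t \<in> H_space L"
    and rate: "\<And>t. 0 \<le> t \<Longrightarrow>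
      ((\<lambda>s. norm_H L (state_diff (state_scale (1 / (s - t))
          (state_diff (z s, zdot z s) (z t, zdot z t))) (w' t))) \<longlongrightarrow> 0) (at t within {0..})"
    and pde: "\<And>t. 0 < t \<Longrightarrow> AE x in lebesgue_on {0<..<L}.
      snd (w' t) x + wderivs L 4 (z t) x + B\<^sup>2 * wderiv L (J L C P (wderiv L (z t))) x = 0"
begin

definition acc :: "real \<Rightarrow> real \<Rightarrow> real" where "acc t = snd (w' t)"

text \<open>The defect of the difference quotient in \<open>V_space\<close>. At \<open>s = t\<close>
  the quotient is 0 by the division convention, which does not affect limits taken in a punctured
  neighbourhood.\<close>

definition err :: "real \<Rightarrow> real \<Rightarrow> real \<Rightarrow> real" where
  "err t s = (\<lambda>x. 1 / (s - t) * (z s x - z t x) - fst (w' t) x)"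

lemma V_z: "0 \<le> t \<Longrightarrow> z t \<in> V_space L" and V_zdot: "0 \<le> t \<Longrightarrow> zdot z t \<in> V_space L"
  using D_spaceD[OF L C P dom] by auto

lemma V_rate: "0 \<le> t \<Longrightarrow> fst (w' t) \<in> V_space L" and L2_acc: "0 \<le> t \<Longrightarrow> L2 L (acc t)"
  using rate_dom[of t] by (auto simp: H_space_def acc_def)

lemma C1_on_err:
  assumes "0 \<le> t" "0 \<le> s"
  shows "C1_on L (err t s) (\<lambda>x. 1 / (s - t) * (wderiv L (z s) x - wderiv L (z t) x)
    - wderiv L (fst (w' t)) x)" "err t s 0 = 0"
proof -
  show "C1_on L (err t s) (\<lambda>x. 1 / (s - t) * (wderiv L (z s) x - wderiv L (z t) x)
      - wderiv L (fst (w' t)) x)"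
    unfolding err_def by (intro C1_on_diff C1_on_cmult V_spaceD(1)[OF L] V_z V_rate assms)
  show "err t s 0 = 0"
    using V_spaceD(2)[OF L V_z[OF assms(1)]] V_spaceD(2)[OF L V_z[OF assms(2)]]
      V_spaceD(2)[OF L V_rate[OF assms(1)]] by (simp add: err_def)
qed

lemma eventually_nonneg: "\<forall>\<^sub>F s in at t within {0..}. (0::real) \<le> s"
  by (auto simp: eventually_at_filter)

lemma rate_limits:
  assumes t: "0 \<le> t"
  shows "((\<lambda>s. norm_H2 L (err t s)) \<longlongrightarrow> 0) (at t within {0..})"
    and "((\<lambda>s. norm_L2 L (\<lambda>x. 1 / (s - t) * (zdot z s x - zdot z t x) - acc t x)) \<longlongrightarrow> 0)
      (at t within {0..})"
proof -
  let ?q = "\<lambda>s. state_diff (state_scale (1 / (s - t))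
    (state_diff (z s, zdot z s) (z t, zdot z t))) (w' t)"
  have q: "fst (?q s) = err t s"
    "snd (?q s) = (\<lambda>x. 1 / (s - t) * (zdot z s x - zdot z t x) - acc t x)" for s
    by (simp_all add: state_diff_def state_scale_def err_def acc_def)
  show "((\<lambda>s. norm_H2 L (err t s)) \<longlongrightarrow> 0) (at t within {0..})"
  proof (rule Lim_null_comparison[OF _ rate[OF t]], rule always_eventually, rule allI)
    show "norm (norm_H2 L (err t s)) \<le> norm_H L (?q s)" for s
      using norm_H_ge(1)[of L "?q s"] unfolding q by simp
  qed
  show "((\<lambda>s. norm_L2 L (\<lambda>x. 1 / (s - t) * (zdot z s x - zdot z t x) - acc t x)) \<longlongrightarrow> 0)
      (at t within {0..})"
    by (rule tendsto_0_norm_L2[OF rate[OF t]], rule always_eventually)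
      (use norm_H_ge(2)[of L "?q _"] in \<open>auto simp: q\<close>)
qed

text \<open>Convergence in \<open>V\<close> implies pointwise convergence.\<close>

lemma zdot_eq:
  assumes t: "0 \<le> t" and x: "x \<in> {0..L}"
  shows "zdot z t x = fst (w' t) x"
proof -
  have "((\<lambda>s. err t s x) \<longlongrightarrow> 0) (at t within {0..})"
  proof (rule Lim_null_comparison)
    show "\<forall>\<^sub>F s in at t within {0..}. norm (err t s x) \<le> sqrt L * norm_H2 L (err t s)"
      using eventually_nonneg
    proof eventually_elim
      case (elim s)
      have "\<bar>err t s x\<bar> \<le> sqrt L * norm_L2 L (wderiv L (err t s))"
        using C1_on_err[OF t elim] C1_on_wderiv(1)[OF L] x by (intro C1_on_sup_bound) auto
      also have "\<dots> \<le> sqrt L * norm_H2 L (err t s)"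
        using L norm_H2_ge(2) by (intro mult_left_mono) auto
      finally show ?case by simp
    qed
    show "((\<lambda>s. sqrt L * norm_H2 L (err t s)) \<longlongrightarrow> 0) (at t within {0..})"
      using rate_limits(1)[OF t] by (rule tendsto_mult_right_zero)
  qed
  then have "((\<lambda>s. (z s x - z t x) / (s - t) - fst (w' t) x) \<longlongrightarrow> 0) (at t within {0..})"
    by (simp add: err_def)
  then have "((\<lambda>s. z s x) has_real_derivative fst (w' t) x) (at t within {0..})"
    unfolding has_field_derivative_iff by (rule LIM_zero_cancel)
  then show ?thesis
    unfolding zdot_def
    by (intro vector_derivative_within at_within_Ici_nontrivial t)
      (simp add: has_real_derivative_iff_has_vector_derivative)
qed

lemma wderiv_rate: "0 \<le> t \<Longrightarrow> wderiv L (fst (w' t)) = wderiv L (zdot z t)"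
  by (rule wderiv_cong) (simp add: zdot_eq)

lemma wderiv_err:
  assumes "0 \<le> t" "0 \<le> s" "x \<in> {0..L}"
  shows "wderiv L (err t s) x
    = 1 / (s - t) * (wderiv L (z s) x - wderiv L (z t) x) - wderiv L (zdot z t) x"
  using C1_on_wderiv(2)[OF L C1_on_err(1)[OF assms(1,2)] assms(3)] wderiv_rate[OF assms(1)] by simp

lemma rate_limit_z:
  assumes t: "0 \<le> t"
  shows "((\<lambda>s. norm_L2 L (\<lambda>x. 1 / (s - t) * (z s x - z t x) - zdot z t x)) \<longlongrightarrow> 0)
    (at t within {0..})"
proof (rule tendsto_0_norm_L2[OF rate_limits(1)[OF t]], rule always_eventually, rule allI)
  show "norm_L2 L (\<lambda>x. 1 / (s - t) * (z s x - z t x) - zdot z t x) \<le> norm_H2 L (err t s)" for s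
    using norm_H2_ge(1)[of L "err t s"]
      norm_L2_cong[of L "\<lambda>x. 1 / (s - t) * (z s x - z t x) - zdot z t x" "err t s"]
    by (simp add: err_def zdot_eq[OF t])
qed

lemma rate_limit_dz:
  assumes t: "0 \<le> t"
  shows "((\<lambda>s. norm_L2 L (\<lambda>x. 1 / (s - t) * (wderiv L (z s) x - wderiv L (z t) x)
    - wderiv L (zdot z t) x)) \<longlongrightarrow> 0) (at t within {0..})"
proof (rule tendsto_0_norm_L2[OF rate_limits(1)[OF t]])
  show "\<forall>\<^sub>F s in at t within {0..}. norm_L2 L (\<lambda>x. 1 / (s - t) * (wderiv L (z s) x - wderiv L (z t) x)
    - wderiv L (zdot z t) x) \<le> norm_H2 L (err t s)"
    using eventually_nonneg
  proof eventually_elim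
    case (elim s)
    then show ?case
      using norm_H2_ge(2)[of L "err t s"] norm_L2_cong[of L "wderiv L (err t s)"
          "\<lambda>x. 1 / (s - t) * (wderiv L (z s) x - wderiv L (z t) x) - wderiv L (zdot z t) x"]
      by (simp add: wderiv_err[OF t elim])
  qed
qed

text \<open>The quotient of z'' minus the second derivative of the velocity, and the chosen second
  derivative of \<open>err\<close>, are both weak derivatives of one continuous function, so they
  have equal pairings with C^1 functions.\<close>

lemma second_derivative_err:
  assumes t: "0 \<le> t" and s: "0 \<le> s"
  shows "L2 L (wderivs L 2 (err t s))"
    and "C1_on L p p' \<Longrightarrow> ip L (\<lambda>x. 1 / (s - t) * (wderivs L 2 (z s) x - wderivs L 2 (z t) x)) p
      = ip L (\<lambda>x. wderivs L 2 (zdot z t) x + wderivs L 2 (err t s) x) p"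
proof -
  let ?f = "\<lambda>x. 1 / (s - t) * (wderiv L (z s) x - wderiv L (z t) x) - wderiv L (zdot z t) x"
  let ?q = "\<lambda>x. 1 / (s - t) * (wderivs L 2 (z s) x - wderivs L 2 (z t) x)"
  have two: "wderivs L 2 v = wderiv L (wderiv L v)" for v by (simp add: numeral_2_eq_2)
  note zs = D_spaceD(3)[OF L C P dom[OF s]] and zt = D_spaceD(3)[OF L C P dom[OF t]]
    and v = V_spaceD[OF L V_zdot[OF t]]
  have q: "C1_on L (\<lambda>x. 1 / (s - t) * (wderiv L (z s) x - wderiv L (z t) x)) ?q"
    by (intro C1_on_cmult C1_on_diff zs zt)
  have "weak_deriv L (\<lambda>x. 1 * (1 / (s - t) * (wderiv L (z s) x - wderiv L (z t) x))
      + (-1) * wderiv L (zdot z t) x) (\<lambda>x. 1 * ?q x + (-1) * wderivs L 2 (zdot z t) x)"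
    by (rule weak_deriv_lin[OF C1_on_weak_deriv[OF L q] v(4)])
  then have f: "weak_deriv L ?f (\<lambda>x. ?q x - wderivs L 2 (zdot z t) x)" by simp
  have cf: "continuous_on {0..L} ?f"
    by (intro continuous_on_diff C1_on_continuous[OF q] C1_on_continuous_deriv[OF v(1)])
  have "wderiv L ?f = wderiv L (wderiv L (err t s))"
    by (rule wderiv_cong) (simp add: wderiv_err[OF t s])
  then have f2: "weak_deriv L ?f (wderivs L 2 (err t s))"
    unfolding two using weak_deriv_wderiv[OF f] by simp
  show l2: "L2 L (wderivs L 2 (err t s))" by (rule weak_deriv_L2[OF f2])
  show "ip L ?q p = ip L (\<lambda>x. wderivs L 2 (zdot z t) x + wderivs L 2 (err t s) x) p"
    if p: "C1_on L p p'"
    using weak_deriv_ip_unique[OF L f f2 cf p] C1_on_L2(2)[OF q] weak_deriv_L2[OF v(4)] l2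
      C1_on_L2(1)[OF p] by (simp only: ip_diff ip_add)
qed

text \<open>On \<open>{0..L}\<close> classical derivatives of differences are differences of
  derivatives, so the graph norm dominates all four quantities.\<close>

lemma continuity_limits:
  assumes t: "0 \<le> t"
  shows "((\<lambda>s. norm_L2 L (\<lambda>x. wderiv L (z s) x - wderiv L (z t) x)) \<longlongrightarrow> 0) (at t within {0..})"
    and "((\<lambda>s. norm_L2 L (\<lambda>x. wderivs L 2 (z s) x - wderivs L 2 (z t) x)) \<longlongrightarrow> 0) (at t within {0..})"
    and "((\<lambda>s. norm_L2 L (\<lambda>x. zdot z s x - zdot z t x)) \<longlongrightarrow> 0) (at t within {0..})"
    and "((\<lambda>s. norm_L2 L (\<lambda>x. wderiv L (zdot z s) x - wderiv L (zdot z t) x)) \<longlongrightarrow> 0)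
      (at t within {0..})"
proof -
  let ?N = "\<lambda>s. norm_D L B C P (state_diff (z s, zdot z s) (z t, zdot z t))"
  have fs: "norm_H2 L (\<lambda>x. z s x - z t x) \<le> ?N s" "norm_H2 L (\<lambda>x. zdot z s x - zdot z t x) \<le> ?N s"
    for s
    using order_trans[OF norm_H_ge(1) norm_D_ge(1),
        of L "state_diff (z s, zdot z s) (z t, zdot z t)"]
      norm_D_ge(2)[of L "state_diff (z s, zdot z s) (z t, zdot z t)"]
    by (simp_all add: state_diff_def)
  have bound: "norm_L2 L (\<lambda>x. wderiv L (z s) x - wderiv L (z t) x) \<le> ?N s"
    "norm_L2 L (\<lambda>x. wderivs L 2 (z s) x - wderivs L 2 (z t) x) \<le> ?N s"
    "norm_L2 L (\<lambda>x. zdot z s x - zdot z t x) \<le> ?N s"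
    "norm_L2 L (\<lambda>x. wderiv L (zdot z s) x - wderiv L (zdot z t) x) \<le> ?N s"
    if s: "0 \<le> s" for s
  proof -
    have two: "wderivs L 2 v = wderiv L (wderiv L v)" for v by (simp add: numeral_2_eq_2)
    note d1 = C1_on_wderiv(2)[OF L C1_on_diff[OF V_spaceD(1)[OF L V_z[OF s]]
          V_spaceD(1)[OF L V_z[OF t]]]]
    have "wderivs L 2 (\<lambda>x. z s x - z t x) = wderiv L (\<lambda>x. wderiv L (z s) x - wderiv L (z t) x)"
      unfolding two by (rule wderiv_cong) (simp add: d1)
    then have d2: "wderivs L 2 (\<lambda>x. z s x - z t x) x = wderivs L 2 (z s) x - wderivs L 2 (z t) x"
      if "x \<in> {0..L}" for x
      using C1_on_wderiv(2)[OF L C1_on_diff[OF D_spaceD(3)[OF L C P dom[OF s]]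
          D_spaceD(3)[OF L C P dom[OF t]]] that] by simp
    note d3 = C1_on_wderiv(2)[OF L C1_on_diff[OF V_spaceD(1)[OF L V_zdot[OF s]]
          V_spaceD(1)[OF L V_zdot[OF t]]]]
    have "norm_L2 L (\<lambda>x. wderiv L (z s) x - wderiv L (z t) x)
        = norm_L2 L (wderiv L (\<lambda>x. z s x - z t x))"
      by (rule norm_L2_cong) (simp add: d1)
    then show "norm_L2 L (\<lambda>x. wderiv L (z s) x - wderiv L (z t) x) \<le> ?N s"
      using order_trans[OF norm_H2_ge(2) fs(1)] by simp
    have "norm_L2 L (\<lambda>x. wderivs L 2 (z s) x - wderivs L 2 (z t) x)
        = norm_L2 L (wderivs L 2 (\<lambda>x. z s x - z t x))"
      by (rule norm_L2_cong) (simp add: d2)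
    then show "norm_L2 L (\<lambda>x. wderivs L 2 (z s) x - wderivs L 2 (z t) x) \<le> ?N s"
      using order_trans[OF norm_H2_ge(3) fs(1)] by simp
    show "norm_L2 L (\<lambda>x. zdot z s x - zdot z t x) \<le> ?N s"
      by (rule order_trans[OF norm_H2_ge(1) fs(2)])
    have "norm_L2 L (\<lambda>x. wderiv L (zdot z s) x - wderiv L (zdot z t) x)
        = norm_L2 L (wderiv L (\<lambda>x. zdot z s x - zdot z t x))"
      by (rule norm_L2_cong) (simp add: d3)
    then show "norm_L2 L (\<lambda>x. wderiv L (zdot z s) x - wderiv L (zdot z t) x) \<le> ?N s"
      using order_trans[OF norm_H2_ge(2) fs(2)] by simp
  qed
  show "((\<lambda>s. norm_L2 L (\<lambda>x. wderiv L (z s) x - wderiv L (z t) x)) \<longlongrightarrow> 0) (at t within {0..})"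
    "((\<lambda>s. norm_L2 L (\<lambda>x. wderivs L 2 (z s) x - wderivs L 2 (z t) x)) \<longlongrightarrow> 0) (at t within {0..})"
    "((\<lambda>s. norm_L2 L (\<lambda>x. zdot z s x - zdot z t x)) \<longlongrightarrow> 0) (at t within {0..})"
    "((\<lambda>s. norm_L2 L (\<lambda>x. wderiv L (zdot z s) x - wderiv L (zdot z t) x)) \<longlongrightarrow> 0)
      (at t within {0..})"
    by (rule tendsto_0_norm_L2[OF cont[OF t]], rule eventually_mono[OF eventually_nonneg],
        erule bound)+
qed

text \<open>Continuity in the graph norm controls the spatial derivative of the velocity, and the
  sup bound passes this to the trace at \<open>L\<close>. The observed integrand is thereby
  integrable.\<close>

lemma tip_velocity_continuous: "continuous_on {0..} (\<lambda>t. zdot z t L)"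
  unfolding continuous_on_def
proof
  fix t :: real assume "t \<in> {0..}"
  then have t: "0 \<le> t" by simp
  have "((\<lambda>s. zdot z s L - zdot z t L) \<longlongrightarrow> 0) (at t within {0..})"
  proof (rule Lim_null_comparison)
    show "\<forall>\<^sub>F s in at t within {0..}. norm (zdot z s L - zdot z t L)
        \<le> sqrt L * norm_L2 L (\<lambda>x. wderiv L (zdot z s) x - wderiv L (zdot z t) x)"
      using eventually_nonneg
    proof eventually_elim
      case (elim s)
      note vs = V_spaceD[OF L V_zdot[OF elim]] and vt = V_spaceD[OF L V_zdot[OF t]]
      show ?case
        using C1_on_sup_bound[OF C1_on_diff[OF vs(1) vt(1)], of L] vs(2) vt(2) L by simp
    qed
    show "((\<lambda>s. sqrt L * norm_L2 L (\<lambda>x. wderiv L (zdot z s) x - wderiv L (zdot z t) x)) \<longlongrightarrow> 0)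
        (at t within {0..})"
      using continuity_limits(4)[OF t] by (rule tendsto_mult_right_zero)
  qed
  then show "((\<lambda>t. zdot z t L) \<longlongrightarrow> zdot z t L) (at t within {0..})" by (rule LIM_zero_cancel)
qed

end

text \<open>A difference of squares for bilinear forms: the hypothesis on cross terms is symmetry,
  supplied by \<open>ip_commute\<close> or by the symmetry of J.\<close>

lemma ip_diff_quotient:
  assumes "L2 L f" "L2 L g" "L2 L f'" "L2 L g'" "ip L f g' = ip L f' g"
  shows "ip L (\<lambda>x. f x + f' x) (\<lambda>x. c * (g x - g' x)) = c * (ip L f g - ip L f' g')"
proof -
  have "ip L (\<lambda>x. f x + f' x) (\<lambda>x. c * (g x - g' x))
      = c * ((ip L f g - ip L f g') + (ip L f' g - ip L f' g'))"
    using assms(1-4) by (simp only: ip_cmult ip_add ip_diff L2_diff)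
  then show ?thesis using assms(5) by simp
qed

context beam_curve
begin

lemma state_L2:
  assumes "0 \<le> s"
  shows "L2 L (z s)" "L2 L (wderiv L (z s))" "L2 L (wderivs L 2 (z s))" "L2 L (zdot z s)"
    "L2 L (wderiv L (zdot z s))" "L2 L (wderivs L 2 (zdot z s))"
  using C1_on_L2[OF V_spaceD(1)[OF L V_z[OF assms]]] C1_on_L2[OF V_spaceD(1)[OF L V_zdot[OF assms]]]
    C1_on_L2[OF D_spaceD(3)[OF L C P dom[OF assms]]] weak_deriv_L2[OF V_spaceD(4)[OF L V_zdot[OF assms]]]
  by auto

lemma J_bvp:
  assumes "0 \<le> s"
  obtains u u1 where "elliptic_bvp L C P (wderiv L (z s)) u u1 (J L C P (wderiv L (z s)))"
  by (rule J_elliptic_bvp[OF L C P C1_on_continuous_deriv[OF V_spaceD(1)[OF L V_z[OF assms]]]])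

lemma J_L2: "0 \<le> s \<Longrightarrow> L2 L (J L C P (wderiv L (z s)))"
  by (rule J_bvp) (auto dest: elliptic_bvp_L2)

lemma J_symmetric:
  assumes "0 \<le> s" "0 \<le> t"
  shows "ip L (J L C P (wderiv L (z s))) (wderiv L (z t))
    = ip L (J L C P (wderiv L (z t))) (wderiv L (z s))"
proof -
  obtain u u1 v v1 where "elliptic_bvp L C P (wderiv L (z s)) u u1 (J L C P (wderiv L (z s)))"
    "elliptic_bvp L C P (wderiv L (z t)) v v1 (J L C P (wderiv L (z t)))"
    using J_bvp[OF assms(1)] J_bvp[OF assms(2)] by metis
  then show ?thesis by (rule elliptic_bvp_symmetric[OF L])
qed

lemma eventually_nonneg_neq: "\<forall>\<^sub>F s in at t within {0..}. (0::real) \<le> s \<and> s \<noteq> t"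
  by (auto simp: eventually_at_filter)

lemma J_continuity_limit:
  assumes t: "0 \<le> t"
  shows "((\<lambda>s. norm_L2 L (\<lambda>x. J L C P (wderiv L (z s)) x - J L C P (wderiv L (z t)) x)) \<longlongrightarrow> 0)
    (at t within {0..})"
proof (rule tendsto_0_norm_L2)
  show "((\<lambda>s. norm_L2 L (\<lambda>x. wderiv L (z s) x - wderiv L (z t) x) / C) \<longlongrightarrow> 0) (at t within {0..})"
    using continuity_limits(1)[OF t] by (rule tendsto_divide_zero)
  show "\<forall>\<^sub>F s in at t within {0..}.
      norm_L2 L (\<lambda>x. J L C P (wderiv L (z s)) x - J L C P (wderiv L (z t)) x)
        \<le> norm_L2 L (\<lambda>x. wderiv L (z s) x - wderiv L (z t) x) / C"
    using eventually_nonneg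
  proof eventually_elim
    case (elim s)
    obtain u u1 where 1: "elliptic_bvp L C P (wderiv L (z s)) u u1 (J L C P (wderiv L (z s)))"
      by (rule J_bvp[OF elim])
    obtain v v1 where 2: "elliptic_bvp L C P (wderiv L (z t)) v v1 (J L C P (wderiv L (z t)))"
      by (rule J_bvp[OF t])
    show ?case by (rule elliptic_bvp_bounded[OF L C P elliptic_bvp_diff[OF 1 2]])
  qed
qed

text \<open>The second spatial derivative of the difference quotient of \<open>z\<close> is only compared with
  \<open>(zdot z t)''\<close> after pairing with a \<open>C\<^sup>1\<close> function, because \<open>(zdot z t)''\<close> is merely in \<open>L\<^sup>2\<close>.\<close>

lemma energy_has_derivative:
  assumes t: "0 \<le> t"
  shows "((\<lambda>s. beam_energy L B C P (z s) (zdot z s)) has_real_derivative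
    ip L (acc t) (zdot z t) + ip L (wderivs L 2 (z t)) (wderivs L 2 (zdot z t))
      - B\<^sup>2 * ip L (J L C P (wderiv L (z t))) (wderiv L (zdot z t))) (at t within {0..})"
proof -
  let ?F = "at t within {0..}"
  let ?j = "\<lambda>s. J L C P (wderiv L (z s))" and ?w = "\<lambda>s. wderiv L (z s)"
    and ?w2 = "\<lambda>s. wderivs L 2 (z s)" and ?v = "\<lambda>s. zdot z s"
  note l2t = state_L2[OF t] J_L2[OF t] L2_acc[OF t]
  \<comment> \<open>Each quadratic term of the energy is differentiated as a sum at times s and t
    paired with a difference quotient; this gives the limit of the first factor.\<close>
  have sum_lim: "((\<lambda>s. norm_L2 L (\<lambda>x. (f s x + f t x) - (f t x + f t x))) \<longlongrightarrow> 0) ?F"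
    if "((\<lambda>s. norm_L2 L (\<lambda>x. f s x - f t x)) \<longlongrightarrow> 0) ?F" for f :: "real \<Rightarrow> real \<Rightarrow> real"
    using that by simp
  have 1: "((\<lambda>s. ip L (\<lambda>x. ?v s x + ?v t x) (\<lambda>x. 1 / (s - t) * (?v s x - ?v t x)))
      \<longlongrightarrow> ip L (\<lambda>x. ?v t x + ?v t x) (acc t)) ?F"
  proof (rule ip_tendsto[OF _ _ _ sum_lim[OF continuity_limits(3)[OF t]] rate_limits(2)[OF t]])
    show "\<forall>\<^sub>F s in ?F. L2 L (\<lambda>x. ?v s x + ?v t x) \<and> L2 L (\<lambda>x. 1 / (s - t) * (?v s x - ?v t x))"
      using eventually_nonneg
      by eventually_elim (intro conjI L2_add L2_cmult L2_diff l2t state_L2; assumption)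
  qed (intro L2_add l2t)+
  have err0: "((\<lambda>s. norm_L2 L (\<lambda>x. (wderivs L 2 (?v t) x + wderivs L 2 (err t s) x)
      - wderivs L 2 (?v t) x)) \<longlongrightarrow> 0) ?F"
    by (rule tendsto_0_norm_L2[OF rate_limits(1)[OF t]]) (simp add: norm_H2_ge(3))
  have 2: "((\<lambda>s. ip L (\<lambda>x. ?w2 s x + ?w2 t x) (\<lambda>x. wderivs L 2 (?v t) x + wderivs L 2 (err t s) x))
      \<longlongrightarrow> ip L (\<lambda>x. ?w2 t x + ?w2 t x) (wderivs L 2 (?v t))) ?F"
  proof (rule ip_tendsto[OF _ _ _ sum_lim[OF continuity_limits(2)[OF t]] err0])
    show "\<forall>\<^sub>F s in ?F. L2 L (\<lambda>x. ?w2 s x + ?w2 t x)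
        \<and> L2 L (\<lambda>x. wderivs L 2 (?v t) x + wderivs L 2 (err t s) x)"
      using eventually_nonneg
      by eventually_elim (intro conjI L2_add l2t state_L2 second_derivative_err(1)[OF t]; assumption)
  qed (intro L2_add l2t)+
  have 3: "((\<lambda>s. ip L (\<lambda>x. ?j s x + ?j t x) (\<lambda>x. 1 / (s - t) * (?w s x - ?w t x)))
      \<longlongrightarrow> ip L (\<lambda>x. ?j t x + ?j t x) (wderiv L (?v t))) ?F"
  proof (rule ip_tendsto[OF _ _ _ sum_lim[OF J_continuity_limit[OF t]] rate_limit_dz[OF t]])
    show "\<forall>\<^sub>F s in ?F. L2 L (\<lambda>x. ?j s x + ?j t x) \<and> L2 L (\<lambda>x. 1 / (s - t) * (?w s x - ?w t x))"
      using eventually_nonneg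
      by eventually_elim (intro conjI L2_add L2_cmult L2_diff l2t state_L2 J_L2; assumption)
  qed (intro L2_add l2t)+
  note lim = tendsto_mult_left[OF tendsto_diff[OF tendsto_add[OF 1 2] tendsto_mult_left[OF 3, of "B\<^sup>2"]],
      of "1 / 2"]
  have limit_eq: "1 / 2 * (ip L (\<lambda>x. ?v t x + ?v t x) (acc t)
      + ip L (\<lambda>x. ?w2 t x + ?w2 t x) (wderivs L 2 (?v t))
      - B\<^sup>2 * ip L (\<lambda>x. ?j t x + ?j t x) (wderiv L (?v t)))
    = ip L (acc t) (zdot z t) + ip L (wderivs L 2 (z t)) (wderivs L 2 (zdot z t))
      - B\<^sup>2 * ip L (J L C P (wderiv L (z t))) (wderiv L (zdot z t))"
    using l2t ip_commute[of L "acc t" "?v t"] by (simp only: ip_add) (simp add: field_simps)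
  show ?thesis
    unfolding has_field_derivative_iff
  proof (rule Lim_transform_eventually)
    show "((\<lambda>s. 1 / 2 * (ip L (\<lambda>x. ?v s x + ?v t x) (\<lambda>x. 1 / (s - t) * (?v s x - ?v t x))
        + ip L (\<lambda>x. ?w2 s x + ?w2 t x) (\<lambda>x. wderivs L 2 (?v t) x + wderivs L 2 (err t s) x)
        - B\<^sup>2 * ip L (\<lambda>x. ?j s x + ?j t x) (\<lambda>x. 1 / (s - t) * (?w s x - ?w t x))))
      \<longlongrightarrow> ip L (acc t) (zdot z t) + ip L (wderivs L 2 (z t)) (wderivs L 2 (zdot z t))
      - B\<^sup>2 * ip L (J L C P (wderiv L (z t))) (wderiv L (zdot z t))) ?F"
      using lim unfolding limit_eq .
    show "\<forall>\<^sub>F s in ?F. 1 / 2 * (ip L (\<lambda>x. ?v s x + ?v t x) (\<lambda>x. 1 / (s - t) * (?v s x - ?v t x))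
        + ip L (\<lambda>x. ?w2 s x + ?w2 t x) (\<lambda>x. wderivs L 2 (?v t) x + wderivs L 2 (err t s) x)
        - B\<^sup>2 * ip L (\<lambda>x. ?j s x + ?j t x) (\<lambda>x. 1 / (s - t) * (?w s x - ?w t x)))
      = (beam_energy L B C P (z s) (zdot z s) - beam_energy L B C P (z t) (zdot z t)) / (s - t)"
      using eventually_nonneg_neq
    proof eventually_elim
      case (elim s)
      then have s: "0 \<le> s" "s \<noteq> t" by auto
      note l2s = state_L2[OF s(1)] J_L2[OF s(1)]
      \<comment> \<open>The sum of the z'' terms is C^1, as required of the function paired with the
        second derivative of \<open>err\<close>.\<close>
      have C1w: "C1_on L (\<lambda>x. ?w2 s x + ?w2 t x) (\<lambda>x. wderivs L 3 (z s) x + wderivs L 3 (z t) x)"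
        by (intro C1_on_add D_spaceD(4)[OF L C P dom[OF s(1)]] D_spaceD(4)[OF L C P dom[OF t]])
      have a: "ip L (\<lambda>x. ?v s x + ?v t x) (\<lambda>x. 1 / (s - t) * (?v s x - ?v t x))
          = 1 / (s - t) * (ip L (?v s) (?v s) - ip L (?v t) (?v t))"
        by (intro ip_diff_quotient l2s l2t ip_commute)
      have "ip L (\<lambda>x. ?w2 s x + ?w2 t x) (\<lambda>x. wderivs L 2 (?v t) x + wderivs L 2 (err t s) x)
          = ip L (\<lambda>x. ?w2 s x + ?w2 t x) (\<lambda>x. 1 / (s - t) * (?w2 s x - ?w2 t x))"
        using second_derivative_err(2)[OF t s(1) C1w] by (simp only: ip_commute)
      also have "\<dots> = 1 / (s - t) * (ip L (?w2 s) (?w2 s) - ip L (?w2 t) (?w2 t))"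
        by (intro ip_diff_quotient l2s l2t ip_commute)
      finally have b: "ip L (\<lambda>x. ?w2 s x + ?w2 t x)
          (\<lambda>x. wderivs L 2 (?v t) x + wderivs L 2 (err t s) x) = \<dots>" .
      have c: "ip L (\<lambda>x. ?j s x + ?j t x) (\<lambda>x. 1 / (s - t) * (?w s x - ?w t x))
          = 1 / (s - t) * (ip L (?j s) (?w s) - ip L (?j t) (?w t))"
        by (intro ip_diff_quotient l2s l2t J_symmetric s t)
      have divide_by_gap: "y / (s - t) = 1 / (s - t) * y" for y by simp
      have algebra: "1 / 2 * (r * (p - p') + r * (q - q') - b * (r * (c - c')))
          = r * (1 / 2 * (p + q - b * c) - 1 / 2 * (p' + q' - b * c'))" for r p p' q q' b c c' :: real
        by (simp add: field_simps)
      show ?case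
        unfolding a b c beam_energy_def unfolding divide_by_gap[of "_ - _"] by (rule algebra)
    qed
  qed
qed

lemma multiplier_L2: "0 \<le> s \<Longrightarrow> L2 L (multiplier L k (z s))" "0 \<le> s \<Longrightarrow> L2 L (multiplier L k (zdot z s))"
  unfolding multiplier_def
  by (intro L2_diff L2_cmult norm_L2_times_id(1)[OF L] state_L2; assumption)+

text \<open>Product rule in the order: velocity quotient against the multiplier at time t, plus
  velocity at time s against the multiplier quotient.\<close>

lemma multiplier_has_derivative:
  assumes t: "0 \<le> t"
  shows "((\<lambda>s. ip L (zdot z s) (multiplier L k (z s))) has_real_derivative
    ip L (acc t) (multiplier L k (z t)) + ip L (zdot z t) (multiplier L k (zdot z t)))
      (at t within {0..})"
proof -
  let ?F = "at t within {0..}"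
  let ?M = "\<lambda>s. multiplier L k (z s)" and ?v = "\<lambda>s. zdot z s"
  let ?ew = "\<lambda>s x. 1 / (s - t) * (wderiv L (z s) x - wderiv L (z t) x) - wderiv L (?v t) x"
    and ?ez = "\<lambda>s x. 1 / (s - t) * (z s x - z t x) - ?v t x"
  note l2t = state_L2[OF t] L2_acc[OF t] multiplier_L2[OF t]
  \<comment> \<open>The multiplier is linear in z and bounded by the norms of z' and z, since the
    factor x is at most \<open>L\<close>.\<close>
  have Mlim: "((\<lambda>s. norm_L2 L (\<lambda>x. 1 / (s - t) * (?M s x - ?M t x) - multiplier L k (?v t) x)) \<longlongrightarrow> 0) ?F"
  proof (rule tendsto_0_norm_L2)
    show "((\<lambda>s. L * norm_L2 L (?ew s) + \<bar>- (k / 2)\<bar> * norm_L2 L (?ez s)) \<longlongrightarrow> 0) ?F"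
      by (intro tendsto_add_zero tendsto_mult_right_zero rate_limit_dz rate_limit_z t)
    show "\<forall>\<^sub>F s in ?F. norm_L2 L (\<lambda>x. 1 / (s - t) * (?M s x - ?M t x) - multiplier L k (?v t) x)
        \<le> L * norm_L2 L (?ew s) + \<bar>- (k / 2)\<bar> * norm_L2 L (?ez s)"
      using eventually_nonneg
    proof eventually_elim
      case (elim s)
      have l2: "L2 L (?ew s)" "L2 L (?ez s)"
        by (intro L2_diff L2_cmult l2t state_L2 elim)+
      have eq: "1 / (s - t) * (?M s x - ?M t x) - multiplier L k (?v t) x
          = x * ?ew s x + - (k / 2) * ?ez s x" for x
        unfolding multiplier_def by (simp only: right_diff_distrib) (simp add: algebra_simps)
      show ?case
        unfolding eq norm_L2_cmult[symmetric]
        by (rule order_trans[OF norm_L2_add_le])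
          (use norm_L2_times_id[OF L l2(1)] L2_cmult[OF l2(2), of "- (k / 2)"] in simp_all)
    qed
  qed
  have 1: "((\<lambda>s. ip L (?v s) (\<lambda>x. 1 / (s - t) * (?M s x - ?M t x)))
      \<longlongrightarrow> ip L (?v t) (multiplier L k (?v t))) ?F"
  proof (rule ip_tendsto[OF _ _ _ continuity_limits(3)[OF t] Mlim])
    show "\<forall>\<^sub>F s in ?F. L2 L (?v s) \<and> L2 L (\<lambda>x. 1 / (s - t) * (?M s x - ?M t x))"
      using eventually_nonneg
      by eventually_elim (intro conjI L2_cmult L2_diff l2t state_L2 multiplier_L2; assumption)
  qed (intro l2t)+
  have 2: "((\<lambda>s. ip L (\<lambda>x. 1 / (s - t) * (?v s x - ?v t x)) (?M t)) \<longlongrightarrow> ip L (acc t) (?M t)) ?F"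
  proof (rule ip_tendsto[OF _ _ _ rate_limits(2)[OF t]])
    show "\<forall>\<^sub>F s in ?F. L2 L (\<lambda>x. 1 / (s - t) * (?v s x - ?v t x)) \<and> L2 L (?M t)"
      using eventually_nonneg
      by eventually_elim (intro conjI L2_cmult L2_diff l2t state_L2; assumption)
    show "((\<lambda>s. norm_L2 L (\<lambda>x. ?M t x - ?M t x)) \<longlongrightarrow> 0) ?F"
      by (simp add: norm_L2_def)
  qed (intro l2t)+
  show ?thesis
    unfolding has_field_derivative_iff
  proof (rule Lim_transform_eventually[OF tendsto_add[OF 2 1]])
    show "\<forall>\<^sub>F s in ?F. ip L (\<lambda>x. 1 / (s - t) * (?v s x - ?v t x)) (?M t)
        + ip L (?v s) (\<lambda>x. 1 / (s - t) * (?M s x - ?M t x))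
      = (ip L (?v s) (?M s) - ip L (?v t) (?M t)) / (s - t)"
      using eventually_nonneg
    proof eventually_elim
      case (elim s)
      note l2s = state_L2[OF elim] multiplier_L2[OF elim]
      show ?case
        using l2s l2t by (simp only: ip_cmult ip_diff)
          (simp add: algebra_simps diff_divide_distrib)
    qed
  qed
qed

section \<open>Conservation of energy and integration of the multiplier estimate\<close>

lemma energy_constant:
  assumes "0 \<le> t"
  shows "beam_energy L B C P (z t) (zdot z t) = beam_energy L B C P (z 0) (zdot z 0)"
proof (cases "t = 0")
  case False
  let ?E = "\<lambda>s. beam_energy L B C P (z s) (zdot z s)"
  show ?thesis
  proof (rule DERIV_isconst_end[of 0 t ?E])
    show "0 < t" using False assms by simp
    show "continuous_on {0..t} ?E"
      by (rule DERIV_continuous_on, rule has_field_derivative_subset[OF energy_has_derivative]) auto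
    \<comment> \<open>The equation is available at positive times only; time 0 is reached by
      continuity.\<close>
    fix x :: real assume x: "0 < x" "x < t"
    then have "at x within {0..} = at x" by (intro at_within_interior) simp
    then show "(?E has_real_derivative 0) (at x)"
      using energy_has_derivative[of x] energy_rate_zero[OF L C P dom L2_acc, of x] pde[of x] x
      by (simp add: acc_def)
  qed
qed simp

lemma observability:
  assumes T: "0 \<le> T" and c: "L\<^sup>2 / pi \<le> c" and cT: "2 * c \<le> T"
  shows "2 / L * (T - 2 * c) * beam_energy L B C P (z 0) (zdot z 0)
    \<le> integral {0..T} (\<lambda>t. (zdot z t L)\<^sup>2)"
proof -
  define k where "k = weight L B C P"
  define E where "E = beam_energy L B C P (z 0) (zdot z 0)"
  define X where "X t = ip L (zdot z t) (multiplier L k (z t))" for t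
  define I where "I t = 0 + integral {0..t} (\<lambda>t. (zdot z t L)\<^sup>2)" for t
  \<comment> \<open>By \<open>multiplier_rate\<close> and conservation of energy Y is nonincreasing,
    which is the rate estimate in integrated form.\<close>
  define Y where "Y t = X t - L / 2 * I t + (1 + k) * E * t" for t
  have k: "0 < k" using weight_bounds(1)[OF C P] by (simp add: k_def)
  have E: "0 \<le> E" using multiplier_bound(2)[OF L C P dom[of 0]] by (simp add: E_def)
  have X_le: "\<bar>X t\<bar> \<le> (1 + k) * c * E" if t: "0 \<le> t" for t
  proof -
    have "\<bar>X t\<bar> \<le> (1 + k) * (L\<^sup>2 / pi) * E"
      using multiplier_bound(1)[OF L C P dom[OF t]] energy_constant[OF t]
      by (simp add: X_def k_def E_def)
    also have "\<dots> \<le> (1 + k) * c * E"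
      using c k E by (intro mult_right_mono mult_left_mono) auto
    finally show ?thesis .
  qed
  have "continuous_on {0..T} (\<lambda>t. (zdot z t L)\<^sup>2)"
    by (intro continuous_intros continuous_on_subset[OF tip_velocity_continuous]) auto
  then have I: "C1_on T I (\<lambda>t. (zdot z t L)\<^sup>2)"
    unfolding I_def[abs_def] by (rule C1_on_antiderivative)
  have dY: "(Y has_real_derivative ip L (acc t) (multiplier L k (z t))
      + ip L (zdot z t) (multiplier L k (zdot z t)) - L / 2 * (zdot z t L)\<^sup>2 + (1 + k) * E)
      (at t within {0..T})" if t: "t \<in> {0..T}" for t
  proof -
    have "(X has_real_derivative ip L (acc t) (multiplier L k (z t))
        + ip L (zdot z t) (multiplier L k (zdot z t))) (at t within {0..T})"
      unfolding X_def[abs_def] using t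
      by (intro has_field_derivative_subset[OF multiplier_has_derivative]) auto
    moreover have "((\<lambda>t. (1 + k) * E * t) has_real_derivative (1 + k) * E) (at t within {0..T})"
      by (auto intro!: derivative_eq_intros)
    ultimately show ?thesis
      unfolding Y_def[abs_def]
      by (intro DERIV_add DERIV_diff DERIV_cmult C1_on_deriv[OF I t])
  qed
  have "Y T \<le> Y 0"
  proof (rule DERIV_nonpos_imp_decreasing_open[OF T])
    show "continuous_on {0..T} Y" using dY by (rule DERIV_continuous_on)
    fix t assume t: "0 < t" "t < T"
    have "at t within {0..T} = at t" using t by (intro at_within_Icc_at) auto
    moreover have "ip L (acc t) (multiplier L k (z t)) + ip L (zdot z t) (multiplier L k (zdot z t))
        \<le> L / 2 * (zdot z t L)\<^sup>2 - (1 + k) * E"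
      using multiplier_rate[OF L C P dom L2_acc, of t] pde[of t] t energy_constant[of t]
      by (simp add: acc_def k_def E_def)
    ultimately show "\<exists>y. DERIV Y t :> y \<and> y \<le> 0"
      using dY[of t] t by (intro exI conjI) auto
  qed
  moreover have "I 0 = 0" by (simp add: I_def)
  ultimately have "X T - L / 2 * I T + (1 + k) * E * T \<le> X 0" by (simp add: Y_def)
  then have "(1 + k) * E * T - 2 * ((1 + k) * c * E) \<le> L / 2 * I T"
    using X_le[OF T] X_le[of 0] by (simp add: abs_le_iff)
  \<comment> \<open>The sign of \<open>T - 2 * c\<close> enters here: it allows the factor
    \<open>1 + k\<close> to be lowered to 1.\<close>
  moreover have "(T - 2 * c) * E \<le> (1 + k) * ((T - 2 * c) * E)"
    using k E cT by (simp add: distrib_right)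
  ultimately have "(T - 2 * c) * E \<le> L / 2 * I T" by (simp add: algebra_simps)
  then have "2 / L * ((T - 2 * c) * E) \<le> 2 / L * (L / 2 * I T)"
    using L by (intro mult_left_mono) auto
  moreover have "2 / L * (L / 2 * I T) = I T" using L by simp
  ultimately show ?thesis by (simp only: I_def E_def mult.assoc add_0)
qed

end

lemma energy_eq_beam_energy:
  assumes "0 < L" "0 < C" "0 < P" and d: "(z t, zdot z t) \<in> D_space L B C P"
  shows "energy L B C P z t = beam_energy L B C P (z t) (zdot z t)"
proof -
  note zt = V_spaceD[OF assms(1) D_spaceD(1)[OF assms(1-3) d]]
    and v = V_spaceD[OF assms(1) D_spaceD(2)[OF assms(1-3) d]]
  obtain u u1 where e: "elliptic_bvp L C P (wderiv L (z t)) u u1 (J L C P (wderiv L (z t)))"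
    by (rule J_elliptic_bvp[OF assms(1-3) C1_on_continuous_deriv[OF zt(1)]])
  note l2 = C1_on_L2[OF v(1)] weak_deriv_L2[OF zt(4)] elliptic_bvp_L2(3)[OF e]
  have "energy L B C P z t = 1 / 2 * (LINT x|lebesgue_on {0<..<L}.
      zdot z t x * zdot z t x + wderivs L 2 (z t) x * wderivs L 2 (z t) x
        - B\<^sup>2 * (J L C P (wderiv L (z t)) x * wderiv L (z t) x))"
    by (simp add: energy_def power2_eq_square mult.assoc)
  also have "\<dots> = beam_energy L B C P (z t) (zdot z t)"
    using l2 by (simp only: beam_energy_def ip_def Bochner_Integration.integral_add
        Bochner_Integration.integral_diff Bochner_Integration.integral_mult_right_zero
        L2_mult_integrable Bochner_Integration.integrable_add Bochner_Integration.integrable_mult_right)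
  finally show ?thesis .
qed

theorem theorem2p3:
  fixes L B C P T c :: real
    and z0 z1 :: "real \<Rightarrow> real" and z :: "real \<Rightarrow> real \<Rightarrow> real"
  assumes "L > 0" and "B > 0" and "C > 0" and "P > 0"
    and "c = max L (L ^ 3 / pi\<^sup>2)"
    and "T > 2 * c"
    and "beam_solution L B C P z0 z1 z"
  shows "(LINT t|lebesgue_on {0..T}. \<bar>zdot z t L\<bar>\<^sup>2) \<ge> 2 / L * (T - 2 * c) * energy L B C P z 0"
proof -
  obtain w' where w': "C1_curve (norm_H L) (H_space L) (\<lambda>t. (z t, zdot z t)) w'"
    "\<And>t. t > 0 \<Longrightarrow> AE x in lebesgue_on {0<..<L}.
       snd (w' t) x + wderivs L 4 (z t) x + B\<^sup>2 * wderiv L (J L C P (wderiv L (z t))) x = 0"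
    using assms(7) unfolding beam_solution_def by blast
  have D: "C0_curve (norm_D L B C P) (D_space L B C P) (\<lambda>t. (z t, zdot z t))"
    using assms(7) unfolding beam_solution_def by blast
  interpret beam_curve L B C P z w'
    using assms(1,3,4) D w' unfolding C0_curve_def C1_curve_def by unfold_locales auto
  \<comment> \<open>A geometric mean never exceeds the larger entry; which entry of the maximum is
    larger depends on whether L exceeds \<pi>.\<close>
  have "L\<^sup>2 / pi \<le> c"
  proof (cases "L \<le> pi")
    case True
    then have "L * L \<le> L * pi" using assms(1) by (intro mult_left_mono) auto
    then have "L\<^sup>2 / pi \<le> L" by (simp add: power2_eq_square field_simps)
    then show ?thesis using assms(5) by simp
  next
    case False
    then have "L\<^sup>2 * pi \<le> L\<^sup>2 * L" by (intro mult_left_mono) auto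
    then have "L\<^sup>2 / pi \<le> L ^ 3 / pi\<^sup>2" by (simp add: power2_eq_square power3_eq_cube field_simps)
    then show ?thesis using assms(5) by simp
  qed
  moreover have "0 \<le> T" using assms(1,5,6) by simp
  ultimately have "2 / L * (T - 2 * c) * energy L B C P z 0
      \<le> integral {0..T} (\<lambda>t. (zdot z t L)\<^sup>2)"
    using observability[of T c] assms(6) energy_eq_beam_energy[OF assms(1,3,4) dom[of 0]] by simp
  also have "\<dots> = (LINT t|lebesgue_on {0..T}. (zdot z t L)\<^sup>2)"
  proof (rule lebesgue_integral_eq_integral[symmetric])
    show "integrable (lebesgue_on {0..T}) (\<lambda>t. (zdot z t L)\<^sup>2)"
      by (intro continuous_imp_integrable_real continuous_intros
          continuous_on_subset[OF tip_velocity_continuous]) auto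
  qed simp
  finally show ?thesis by simp
qed

end
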